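(* Let $f\in C^{2}(0,\infty)$ satisfy (P1) there exist $0<\beta_1<\beta_2\le\infty$ such that $f(u)>0$ on $(\beta_1,\beta_2)$ and $f(u)<0$ on $(0,\beta_1)\cup(\beta_2,\infty)$; and (P2) $F(u)=\int_0^u f(t)\,dt$ exists for $u>0$ and there exists $\eta\in(\beta_1,\beta_2)$ with $F(\eta)=0$. Let $S$ be the bifurcation curve of positive solutions of $-u''=\lambda f(u)$ in $(-1,1)$, $u(-1)=u(1)=0$, $\lambda>0$. Let $g(u)=f(u)/u$ and $$G=\int_0^\eta\frac{-\eta f(\eta)-2F(u)+uf(u)}{[-F(u)]^{3/2}}\,du .$$ Consider the conditions: (H1) $g'(u)>0$ for $0<u<\beta_2$. (H2) There exists $\sigma>0$ such that $g'(u)>0$ for $0<u<\sigma$, $g'(\sigma)=0$, and $g'(u)<0$ for $\sigma<u<\beta_2$. (H3) (with $\sigma$ from (H2)) $f$ is geometrically concave on $(\sigma,\beta_2)$, i.e. $f(\sqrt{ab})\ge\sqrt{f(a)f(b)}$ for all $a,b\in(\sigma,\beta_2)$. (H4) $f''(u)<0$ for $0<u<\beta_2$. Then: (i) If (H1) holds, then $S$ is monotone decreasing. (ii) If either (H2) and (H3) hold, or (H2) and (H4) hold, then $S$ is $\subset$-shaped if $G<0$, and is monotone increasing if $G\ge0$.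
   Context: The case $f(0^+)=-\infty$ is allowed. The integral $G$ is improper and may equal $-\infty$ (then $G<0$). The bifurcation curve is $S=\{(\lambda,\|u_\lambda\|_\infty):\lambda>0,\ u_\lambda \text{ is a positive solution of the problem}\}$. It is described by the time map $T(\alpha)=\frac{1}{\sqrt2}\int_0^\alpha\frac{du}{\sqrt{F(\alpha)-F(u)}}$, $\alpha\in(\eta,\beta_2)$: positive solutions $u$ with $\|u\|_\infty=\alpha$ correspond to $T(\alpha)=\sqrt\lambda$, so $S=\{(\lambda,\alpha): \lambda>0,\ \alpha\in(\eta,\beta_2),\ T(\alpha)=\sqrt{\lambda}\}$ (apart from possible finite endpoints). "$S$ is monotone decreasing (increasing)" means $T$ is strictly decreasing (increasing) on $(\eta,\beta_2)$; "$S$ is $\subset$-shaped" means $T$ is strictly decreasing and then strictly increasing on $(\eta,\beta_2)$, i.e. there is $\alpha^*\in(\eta,\beta_2)$ with $T$ strictly decreasing on $(\eta,\alpha^*]$ and strictly increasing on $[\alpha^*,\beta_2)$. *)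

theory Defs
  imports "HOL-Analysis.Analysis"
begin

definition C2_on :: "real set \<Rightarrow> (real \<Rightarrow> real) \<Rightarrow> bool" where
  "C2_on S f \<longleftrightarrow>
     (\<forall>x\<in>S. f field_differentiable at x) \<and>
     (\<forall>x\<in>S. deriv f field_differentiable at x) \<and>
     continuous_on S (deriv (deriv f))"

text \<open>The Henstock-Kurzweil integral agrees with the improper Riemann integral
  and does not depend on the value of \<open>f\<close> at 0, so \<open>f\<close> may be unbounded near 0.\<close>

definition primitive :: "(real \<Rightarrow> real) \<Rightarrow> real \<Rightarrow> real" where
  "primitive f u = integral {0..u} f"

definition positive_solution :: "(real \<Rightarrow> real) \<Rightarrow> real \<Rightarrow> (real \<Rightarrow> real) \<Rightarrow> bool" where
  "positive_solution f l u \<longleftrightarrow>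
     continuous_on {-1..1} u \<and> C2_on {-1<..<1} u \<and>
     (\<forall>x\<in>{-1<..<1}. - deriv (deriv u) x = l * f (u x)) \<and>
     (\<forall>x\<in>{-1<..<1}. u x > 0) \<and>
     u (-1) = 0 \<and> u 1 = 0"

definition bifurcation_curve :: "(real \<Rightarrow> real) \<Rightarrow> (real \<times> real) set" where
  "bifurcation_curve f =
     {(l, SUP x\<in>{-1..1}. \<bar>u x\<bar>) | l u. l > 0 \<and> positive_solution f l u}"

definition time_map :: "(real \<Rightarrow> real) \<Rightarrow> real \<Rightarrow> real" where
  "time_map f \<alpha> =
     1 / sqrt 2 * integral {0..\<alpha>} (\<lambda>u. 1 / sqrt (primitive f \<alpha> - primitive f u))"

definition amplitudes :: "real \<Rightarrow> ereal \<Rightarrow> real set" where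
  "amplitudes \<eta> \<beta> = {\<alpha>. \<eta> < \<alpha> \<and> ereal \<alpha> < \<beta>}"

text \<open>The shape of a curve \<open>S\<close> of pairs (parameter, amplitude) over a set \<open>I\<close> of
  amplitudes is read off from a function \<open>T\<close> describing \<open>S\<close> there. Points of \<open>S\<close>
  with amplitude outside \<open>I\<close> (such as a possible finite endpoint) are disregarded.\<close>

definition described_by :: "(real \<times> real) set \<Rightarrow> (real \<Rightarrow> real) \<Rightarrow> real set \<Rightarrow> bool" where
  "described_by S T I \<longleftrightarrow>
     S \<inter> (UNIV \<times> I) = {(l, \<alpha>). l > 0 \<and> \<alpha> \<in> I \<and> T \<alpha> = sqrt l}"

definition curve_decreasing :: "(real \<times> real) set \<Rightarrow> (real \<Rightarrow> real) \<Rightarrow> real set \<Rightarrow> bool" where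
  "curve_decreasing S T I \<longleftrightarrow> described_by S T I \<and> strict_antimono_on I T"

definition curve_increasing :: "(real \<times> real) set \<Rightarrow> (real \<Rightarrow> real) \<Rightarrow> real set \<Rightarrow> bool" where
  "curve_increasing S T I \<longleftrightarrow> described_by S T I \<and> strict_mono_on I T"

definition curve_subset_shaped :: "(real \<times> real) set \<Rightarrow> (real \<Rightarrow> real) \<Rightarrow> real set \<Rightarrow> bool" where
  "curve_subset_shaped S T I \<longleftrightarrow> described_by S T I \<and>
     (\<exists>\<alpha>\<^sub>0\<in>I. strict_antimono_on {\<alpha>\<in>I. \<alpha> \<le> \<alpha>\<^sub>0} T \<and> strict_mono_on {\<alpha>\<in>I. \<alpha>\<^sub>0 \<le> \<alpha>} T)"

text \<open>Two-sided improper integral, with values in the extended reals. Where it is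
  used, the integrand is continuous on the open interval, is integrable up to \<open>b\<close> and
  is negative near \<open>a\<close>, so the limit exists (possibly \<open>-\<infinity>\<close>).\<close>

definition improper_integral :: "real \<Rightarrow> real \<Rightarrow> (real \<Rightarrow> real) \<Rightarrow> ereal" where
  "improper_integral a b h =
     Lim (at_right a \<times>\<^sub>F at_left b) (\<lambda>(s, t). ereal (integral {s..t} h))"

definition G_integral :: "(real \<Rightarrow> real) \<Rightarrow> real \<Rightarrow> ereal" where
  "G_integral f \<eta> = improper_integral 0 \<eta>
     (\<lambda>u. (- \<eta> * f \<eta> - 2 * primitive f u + u * f u) / (- primitive f u) powr (3/2))"

definition geometrically_concave_on :: "real set \<Rightarrow> (real \<Rightarrow> real) \<Rightarrow> bool" where
  "geometrically_concave_on S f \<longleftrightarrow>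
     (\<forall>a\<in>S. \<forall>b\<in>S. f (sqrt (a * b)) \<ge> sqrt (f a * f b))"

text \<open>\<open>\<beta>\<close> is an extended real because it may be infinite.\<close>

definition quotient_increasing :: "(real \<Rightarrow> real) \<Rightarrow> ereal \<Rightarrow> bool" where
  "quotient_increasing f \<beta> \<longleftrightarrow>
     (\<forall>u. 0 < u \<and> ereal u < \<beta> \<longrightarrow> deriv (\<lambda>t. f t / t) u > 0)"

definition quotient_unimodal :: "(real \<Rightarrow> real) \<Rightarrow> ereal \<Rightarrow> real \<Rightarrow> bool" where
  "quotient_unimodal f \<beta> \<sigma> \<longleftrightarrow> \<sigma> > 0 \<and>
     (\<forall>u. 0 < u \<and> u < \<sigma> \<longrightarrow> deriv (\<lambda>t. f t / t) u > 0) \<and>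
     deriv (\<lambda>t. f t / t) \<sigma> = 0 \<and>
     (\<forall>u. \<sigma> < u \<and> ereal u < \<beta> \<longrightarrow> deriv (\<lambda>t. f t / t) u < 0)"

end

theory Submission
  imports Defs
begin

text \<open>
  Write \<open>\<theta> u = 2 F u - u f u\<close>, so that \<open>\<theta>' u = - u\<^sup>2 g' u\<close>. After the substitution \<open>u = \<alpha> v / \<eta>\<close>
  the time map becomes, up to a constant factor, the integral over \<open>0 < v < \<eta>\<close> of
  \<open>N \<alpha> v = \<alpha> / sqrt (F \<alpha> - F (\<alpha> v / \<eta>))\<close>, and the derivative of \<open>N\<close> with respect to \<open>\<alpha>\<close> has the
  sign of \<open>\<theta> \<alpha> - \<theta> (\<alpha> v / \<eta>)\<close>. Under (H1) the integrand therefore decreases pointwise.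

  Under (H2) it decreases pointwise for \<open>\<alpha> \<le> \<sigma>\<close>. For \<open>\<alpha> \<ge> \<sigma>\<close>, (H3) or (H4) yields a
  reparametrisation of the amplitude, independent of \<open>v\<close>, in which \<open>N\<close> is strictly convex for every
  \<open>v\<close>; hence so is the time map, without differentiating under the integral sign. The slope of
  \<open>N\<close> at \<open>\<alpha> = \<eta>\<close> is a positive multiple of the integrand of \<open>G\<close>, so monotone convergence of
  difference quotients shows that the time map increases from the start exactly if \<open>G \<ge> 0\<close>. It
  increases eventually because \<open>\<theta> \<ge> 0\<close> somewhere beyond \<open>\<sigma>\<close>.
\<close>

text \<open>At \<alpha> = \<eta> the gap \<open>E \<eta> v\<close> vanishes at v = 0 as well as at v
  = \<eta>, so \<open>N \<eta>\<close> and \<open>dN \<eta>\<close> need not be integrable and G may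
  be -\<infinity>: the time map cannot simply be expanded at \<eta>. Chords of \<open>N\<close>
  between amplitudes above \<eta> are integrable, and convexity encloses their slopes between the
  slopes at their ends. Beyond \<sigma>, moreover, \<open>dN\<close> may change sign with v, so only
  second-order information is left. The parameter \<tau> comes from an ansatz: if \<tau> has
  derivative 1 / P, the slope of \<open>N\<close> against \<tau> is \<open>P * dN\<close>, and
  writing P' = m P / \<alpha> leaves one free function m of the amplitude. Up to a positive factor
  the derivative of that slope is a multiple of \<open>cross\<close> plus a square, so m only has to
  make \<open>cross\<close> nonnegative. With m = 3 the \<theta> term of \<open>cross\<close>
  disappears, which is enough when \<theta>' is increasing, as under (H4). Under (H3) what increases
  is q, the derivative of \<theta> with respect to F. For q \<le> 2 the value m = 3 still works; for
  larger q the excess must be compensated, and m = q + 1 does this.\<close>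

section \<open>Integrals of functions that are continuous on an open interval\<close>

lemma integral_pos_real:
  fixes h :: "real \<Rightarrow> real"
  assumes "a < b" "h integrable_on {a..b}" "continuous_on {a<..<b} h"
    and pos: "\<And>x. a < x \<Longrightarrow> x < b \<Longrightarrow> h x > 0"
  shows "integral {a..b} h > 0"
proof -
  \<comment> \<open>Nothing is known at the endpoints, where the integrands in view blow up; the
    minimum over the compact middle third already bounds the integral away from 0.\<close>
  define c d where "c = (2*a+b)/3" and "d = (a+2*b)/3"
  have cd: "a < c" "c < d" "d < b" using \<open>a < b\<close> by (auto simp: c_def d_def field_simps)
  have "continuous_on {c..d} h"
    by (rule continuous_on_subset[OF assms(3)]) (use cd in auto)
  then obtain x0 where x0: "x0 \<in> {c..d}" "\<And>x. x \<in> {c..d} \<Longrightarrow> h x0 \<le> h x"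
    using continuous_attains_inf[of "{c..d}" h] cd by fastforce
  have hi: "h integrable_on {a<..<b}" using assms(2) by (simp add: integrable_on_Icc_iff_Ioo)
  have hc: "h integrable_on {c..d}"
    by (rule integrable_continuous_real[OF \<open>continuous_on {c..d} h\<close>])
  have "0 < h x0 * (d - c)" using pos[of x0] x0 cd by auto
  also have "\<dots> = integral {c..d} (\<lambda>x. h x0)" using cd by simp
  also have "\<dots> \<le> integral {c..d} h"
    by (rule integral_le) (use x0 hc in auto)
  also have "\<dots> \<le> integral {a<..<b} h"
    by (rule integral_subset_le) (use cd hc hi pos in \<open>auto simp: less_imp_le\<close>)
  also have "\<dots> = integral {a..b} h" by (simp add: integral_open_interval_real)
  finally show ?thesis .
qed

lemma integral_strict_mono_real:
  fixes h k :: "real \<Rightarrow> real"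
  assumes "a < b" "h integrable_on {a..b}" "k integrable_on {a..b}"
    and "continuous_on {a<..<b} h" "continuous_on {a<..<b} k"
    and "\<And>x. a < x \<Longrightarrow> x < b \<Longrightarrow> h x < k x"
  shows "integral {a..b} h < integral {a..b} k"
  using integral_pos_real[of a b "\<lambda>x. k x - h x"] assms
  by (auto intro!: integrable_diff continuous_intros simp: integral_diff)

text \<open>Continuity inside supplies the measurability, so a single explicit majorant settles
  integrability although \<open>h\<close> may blow up at the ends.\<close>

lemma integrable_on_bounded_continuous:
  fixes h k :: "real \<Rightarrow> real"
  assumes "k integrable_on {a..b}" "continuous_on {a<..<b} h"
    and "\<And>x. a < x \<Longrightarrow> x < b \<Longrightarrow> \<bar>h x\<bar> \<le> k x"
  shows "h integrable_on {a..b}"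
proof -
  have "h integrable_on {a<..<b}"
  proof (rule measurable_bounded_by_integrable_imp_integrable)
    show "h \<in> borel_measurable (lebesgue_on {a<..<b})"
      by (rule continuous_imp_measurable_on_sets_lebesgue[OF assms(2)]) auto
    show "k integrable_on {a<..<b}" using assms(1) by (simp add: integrable_on_Icc_iff_Ioo)
  qed (use assms(3) in auto)
  then show ?thesis by (simp add: integrable_on_Icc_iff_Ioo)
qed

lemma has_integral_inverse_sqrt:
  fixes a :: real
  assumes "a \<ge> 0"
  shows "((\<lambda>u. 1 / sqrt (a - u)) has_integral 2 * sqrt a) {0..a}"
proof -
  have "((\<lambda>u. 1 / sqrt (a - u)) has_integral (- 2 * sqrt (a - a) - (- 2 * sqrt (a - 0)))) {0..a}"
  proof (rule fundamental_theorem_of_calculus_interior[OF assms])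
    show "continuous_on {0..a} (\<lambda>u. - 2 * sqrt (a - u))" by (intro continuous_intros)
    fix x assume "x \<in> {0<..<a}"
    then show "((\<lambda>u. - 2 * sqrt (a - u)) has_vector_derivative 1 / sqrt (a - x)) (at x)"
      unfolding has_real_derivative_iff_has_vector_derivative[symmetric]
      by (auto intro!: derivative_eq_intros simp: field_simps)
  qed
  then show ?thesis by simp
qed

section \<open>The potential F, the energy gap, and integrability of the time map integrand\<close>

locale time_map_problem =
  fixes f :: "real \<Rightarrow> real" and \<beta>\<^sub>1 \<eta> :: real and \<beta>\<^sub>2 :: ereal
  assumes C2: "C2_on {0<..} f"
    and \<beta>\<^sub>1_pos: "0 < \<beta>\<^sub>1" and \<beta>\<^sub>1_less: "ereal \<beta>\<^sub>1 < \<beta>\<^sub>2"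
    and f_pos: "\<And>u. \<beta>\<^sub>1 < u \<Longrightarrow> ereal u < \<beta>\<^sub>2 \<Longrightarrow> f u > 0"
    and f_neg: "\<And>u. 0 < u \<Longrightarrow> u < \<beta>\<^sub>1 \<Longrightarrow> f u < 0"
    and f_neg': "\<And>u. \<beta>\<^sub>2 < ereal u \<Longrightarrow> f u < 0"
    and f_int: "\<And>u. 0 < u \<Longrightarrow> f integrable_on {0..u}"
    and \<beta>\<^sub>1_\<eta>: "\<beta>\<^sub>1 < \<eta>" and \<eta>_less: "ereal \<eta> < \<beta>\<^sub>2" and F_\<eta>: "primitive f \<eta> = 0"
begin

abbreviation "F \<equiv> primitive f"
abbreviation "I \<equiv> amplitudes \<eta> \<beta>\<^sub>2"

lemma \<eta>_pos: "0 < \<eta>" using \<beta>\<^sub>1_pos \<beta>\<^sub>1_\<eta> by linarith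

lemma less_\<beta>\<^sub>2: "x \<le> y \<Longrightarrow> ereal y < \<beta>\<^sub>2 \<Longrightarrow> ereal x < \<beta>\<^sub>2"
  by (metis ereal_less_eq(3) order_le_less_trans)

lemma f_deriv: "0 < u \<Longrightarrow> (f has_real_derivative deriv f u) (at u)"
  using C2 unfolding C2_on_def by (simp add: field_differentiable_derivI)

lemma deriv_f_deriv: "0 < u \<Longrightarrow> (deriv f has_real_derivative deriv (deriv f) u) (at u)"
  using C2 unfolding C2_on_def by (simp add: field_differentiable_derivI)

lemma f_cont: "0 < u \<Longrightarrow> isCont f u"
  using f_deriv DERIV_isCont by blast

lemma deriv_f_cont: "0 < u \<Longrightarrow> isCont (deriv f) u"
  using deriv_f_deriv DERIV_isCont by blast

lemma F_deriv:
  assumes "0 < u"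
  shows "(F has_real_derivative f u) (at u)"
proof -
  have "((\<lambda>u. integral {0..u} f) has_vector_derivative f u) (at u within ({0..u+1} - {}))"
    by (rule integral_has_vector_derivative_continuous_at)
      (use assms f_int f_cont in \<open>auto intro: continuous_at_imp_continuous_at_within\<close>)
  then have "((\<lambda>u. integral {0..u} f) has_vector_derivative f u) (at u)"
    using assms at_within_Icc_at[of 0 u "u+1"] by simp
  then show ?thesis
    unfolding has_real_derivative_iff_has_vector_derivative primitive_def[abs_def] .
qed

lemma F_isCont: "0 < u \<Longrightarrow> isCont F u"
  using F_deriv DERIV_isCont by blast

lemma F_0: "F 0 = 0"
  by (simp add: primitive_def)

lemma F_cont: "continuous_on {0..b} F"
proof (cases "0 < b")
  case True
  show ?thesis
    using indefinite_integral_continuous_1[OF f_int[OF True]] unfolding primitive_def[abs_def] .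
next
  case False
  then have "{0..b} \<subseteq> {0}" by auto
  then show ?thesis by (meson continuous_on_sing continuous_on_subset)
qed

lemma F_decreasing:
  assumes "0 \<le> x" "x < y" "y \<le> \<beta>\<^sub>1"
  shows "F y < F x"
  by (rule DERIV_neg_imp_decreasing_open[OF assms(2)])
    (use assms in \<open>auto intro!: exI F_deriv f_neg continuous_on_subset[OF F_cont[of y]]\<close>)

lemma F_increasing:
  assumes "\<beta>\<^sub>1 \<le> x" "x < y" "ereal y < \<beta>\<^sub>2"
  shows "F x < F y"
proof (rule DERIV_pos_imp_increasing_open[OF assms(2)])
  fix u assume u: "x < u" "u < y"
  then have "ereal u < \<beta>\<^sub>2" using less_\<beta>\<^sub>2[of u y] assms by simp
  then show "\<exists>z. (F has_real_derivative z) (at u) \<and> 0 < z"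
    using F_deriv[of u] f_pos[of u] u assms \<beta>\<^sub>1_pos by fastforce
qed (use assms \<beta>\<^sub>1_pos in \<open>auto intro!: continuous_on_subset[OF F_cont[of y]]\<close>)

lemma F_neg: "0 < u \<Longrightarrow> u < \<eta> \<Longrightarrow> F u < 0"
  using F_decreasing[of 0 u] F_increasing[of u \<eta>] F_0 F_\<eta> \<eta>_less \<beta>\<^sub>1_\<eta>
  by (cases "u \<le> \<beta>\<^sub>1") auto

lemma F_pos: "\<eta> < u \<Longrightarrow> ereal u < \<beta>\<^sub>2 \<Longrightarrow> F u > 0"
  using F_increasing[of \<eta> u] F_\<eta> \<beta>\<^sub>1_\<eta> by auto

lemma F_less: "0 < u \<Longrightarrow> u < \<alpha> \<Longrightarrow> \<eta> \<le> \<alpha> \<Longrightarrow> ereal \<alpha> < \<beta>\<^sub>2 \<Longrightarrow> F u < F \<alpha>"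
  using F_neg[of u] F_increasing[of u \<alpha>] F_pos[of \<alpha>] F_\<eta> \<beta>\<^sub>1_\<eta>
  by (cases "u < \<eta>"; cases "\<alpha> = \<eta>") auto

lemma F_less': "0 \<le> u \<Longrightarrow> u < \<alpha> \<Longrightarrow> \<eta> < \<alpha> \<Longrightarrow> ereal \<alpha> < \<beta>\<^sub>2 \<Longrightarrow> F u < F \<alpha>"
  using F_less[of u \<alpha>] F_pos[of \<alpha>] F_0 by (cases "u = 0") auto

text \<open>Near u = \<alpha> the gap vanishes only to first order, because \<open>f\<close> is
  positive there. The constant is uniform over compact sets of amplitudes, so the same inverse
  square root majorant serves for integrability and for dominated convergence in the
  amplitude.\<close>

lemma energy_gap_lower_bound:
  assumes "\<eta> < a" "a \<le> b" "ereal b < \<beta>\<^sub>2"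
  obtains k where "k > 0"
    "\<And>\<alpha> u. a \<le> \<alpha> \<Longrightarrow> \<alpha> \<le> b \<Longrightarrow> 0 \<le> u \<Longrightarrow> u \<le> \<alpha> \<Longrightarrow> k * (\<alpha> - u) \<le> F \<alpha> - F u"
proof -
  define c where "c = (\<beta>\<^sub>1 + \<eta>) / 2"
  have c: "\<beta>\<^sub>1 < c" "c < \<eta>" "0 < c" using \<beta>\<^sub>1_\<eta> \<beta>\<^sub>1_pos by (auto simp: c_def)
  have "continuous_on {c..b} f"
    by (intro continuous_at_imp_continuous_on ballI f_cont) (use c in auto)
  then obtain x0 where x0: "x0 \<in> {c..b}" "\<And>x. x \<in> {c..b} \<Longrightarrow> f x0 \<le> f x"
    using continuous_attains_inf[of "{c..b}" f] c assms by fastforce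
  \<comment> \<open>The first bound is for \<open>u \<ge> c\<close>, by the mean value theorem. The
    second is for \<open>u < c\<close>, where \<open>F u \<le> 0\<close>,
    \<open>F a \<le> F \<alpha>\<close> and \<open>\<alpha> - u \<le> b\<close>.\<close>
  define k where "k = min (f x0) (F a / b)"
  have "f x0 > 0" using f_pos[of x0] x0(1) c less_\<beta>\<^sub>2[of x0 b] assms by auto
  moreover have Fa: "F a > 0" using F_pos[of a] less_\<beta>\<^sub>2[of a b] assms by auto
  ultimately have "k > 0" using assms \<eta>_pos by (auto simp: k_def)
  moreover have "k * (\<alpha> - u) \<le> F \<alpha> - F u" if *: "a \<le> \<alpha>" "\<alpha> \<le> b" "0 \<le> u" "u \<le> \<alpha>" for \<alpha> u
  proof (cases "u < c")
    case True
    have "F u \<le> 0" using F_neg[of u] True c that F_0 by (cases "u = 0") auto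
    moreover have "F a \<le> F \<alpha>"
      using F_increasing[of a \<alpha>] that assms \<beta>\<^sub>1_\<eta> less_\<beta>\<^sub>2[of \<alpha> b] by (cases "a = \<alpha>") auto
    moreover have "k * (\<alpha> - u) \<le> (F a / b) * b"
      by (rule mult_mono) (use that Fa assms \<eta>_pos in \<open>auto simp: k_def\<close>)
    ultimately show ?thesis using assms \<eta>_pos by simp
  next
    case False
    show ?thesis
    proof (cases "u = \<alpha>")
      case False
      then have "u < \<alpha>" using that by simp
      have "\<exists>z. u < z \<and> z < \<alpha> \<and> F \<alpha> - F u = (\<alpha> - u) * f z"
        by (rule MVT2[OF \<open>u < \<alpha>\<close>]) (use \<open>\<not> u < c\<close> c in \<open>auto intro: F_deriv\<close>)
      then obtain z where z: "u < z" "z < \<alpha>" "F \<alpha> - F u = (\<alpha> - u) * f z" by blast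
      have "k \<le> f z" using x0(2)[of z] z that \<open>\<not> u < c\<close> by (auto simp: k_def)
      then show ?thesis using z(3) \<open>u < \<alpha>\<close> by (simp add: mult.commute mult_right_mono)
    qed auto
  qed
  ultimately show ?thesis using that by blast
qed

lemma time_map_integrand_cont:
  assumes "\<alpha> \<in> I"
  shows "continuous_on {0..<\<alpha>} (\<lambda>u. 1 / sqrt (F \<alpha> - F u))"
proof -
  have "continuous_on {0..<\<alpha>} F" by (rule continuous_on_subset[OF F_cont[of \<alpha>]]) auto
  then show ?thesis
    using F_less'[of _ \<alpha>] assms by (auto intro!: continuous_intros simp: amplitudes_def) fastforce
qed

lemma time_map_integrable:
  assumes "\<alpha> \<in> I"
  shows "(\<lambda>u. 1 / sqrt (F \<alpha> - F u)) integrable_on {0..\<alpha>}"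
proof -
  have \<alpha>: "\<eta> < \<alpha>" "ereal \<alpha> < \<beta>\<^sub>2" using assms by (auto simp: amplitudes_def)
  obtain k where k: "k > 0" "\<And>u. 0 \<le> u \<Longrightarrow> u \<le> \<alpha> \<Longrightarrow> k * (\<alpha> - u) \<le> F \<alpha> - F u"
    using energy_gap_lower_bound[of \<alpha> \<alpha>] \<alpha> by (metis order_refl)
  show ?thesis
  proof (rule integrable_on_bounded_continuous)
    show "(\<lambda>u. (1 / sqrt k) * (1 / sqrt (\<alpha> - u))) integrable_on {0..\<alpha>}"
      using has_integral_inverse_sqrt[of \<alpha>] \<alpha> \<eta>_pos
      by (intro integrable_on_mult_right) (auto simp: integrable_on_def)
    show "continuous_on {0<..<\<alpha>} (\<lambda>u. 1 / sqrt (F \<alpha> - F u))"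
      by (rule continuous_on_subset[OF time_map_integrand_cont[OF assms]]) auto
    fix u assume u: "0 < u" "u < \<alpha>"
    have "sqrt (k * (\<alpha> - u)) \<le> sqrt (F \<alpha> - F u)" using k(2)[of u] u by simp
    moreover have "0 < sqrt (k * (\<alpha> - u))" using k(1) u by simp
    ultimately have "1 / sqrt (F \<alpha> - F u) \<le> 1 / sqrt (k * (\<alpha> - u))"
      by (intro divide_left_mono) auto
    then show "\<bar>1 / sqrt (F \<alpha> - F u)\<bar> \<le> (1 / sqrt k) * (1 / sqrt (\<alpha> - u))"
      using F_less[of u \<alpha>] \<alpha> u by (simp add: real_sqrt_mult)
  qed
qed

end

section \<open>Solutions and the time map\<close>

text \<open>Needed at the peak of the constructed solution: there \<open>W\<close> has infinite
  slope and the inverse function rule breaks down, so the formulas valid on both sides are carried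
  across by continuity.\<close>

lemma has_real_derivative_by_continuity:
  fixes h h' :: "real \<Rightarrow> real"
  assumes "isCont h a" "isCont h' a"
    and "\<forall>\<^sub>F x in at a. (h has_real_derivative h' x) (at x)"
  shows "(h has_real_derivative h' a) (at a)"
proof -
  have "((\<lambda>x. (h x - h a) / (x - a)) \<longlongrightarrow> h' a) (at a)"
  proof (rule lhopital[where f' = h' and g' = "\<lambda>_. 1"])
    show "((\<lambda>x. h x - h a) \<longlongrightarrow> 0) (at a)" "((\<lambda>x. x - a) \<longlongrightarrow> 0) (at a)"
      using assms(1) by (auto simp: isCont_def LIM_zero_iff intro!: tendsto_eq_intros)
    show "\<forall>\<^sub>F x in at a. ((\<lambda>x. h x - h a) has_real_derivative h' x) (at x)"
      using assms(3) by eventually_elim (auto intro!: derivative_eq_intros)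
    show "\<forall>\<^sub>F x in at a. x - a \<noteq> 0" by (auto simp: eventually_at intro!: exI[of _ 1])
    show "((\<lambda>x. h' x / 1) \<longlongrightarrow> h' a) (at a)" using assms(2) by (simp add: isCont_def)
  qed (auto intro!: always_eventually derivative_eq_intros)
  then show ?thesis by (simp add: has_field_derivative_iff)
qed

context time_map_problem
begin

text \<open>Conservation of energy gives \<open>u'^2 = 2 * l * (F \<alpha> - F u)\<close>; hence
  \<open>W \<alpha> u / sqrt (2 * l)\<close> is the time in which the solution with maximum \<alpha>
  climbs from 0 to height u.\<close>

definition W :: "real \<Rightarrow> real \<Rightarrow> real" where
  "W \<alpha> u = integral {0..u} (\<lambda>s. 1 / sqrt (F \<alpha> - F s))"

lemma W_0: "W \<alpha> 0 = 0"
  by (simp add: W_def)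

lemma W_amplitude: "W \<alpha> \<alpha> = sqrt 2 * time_map f \<alpha>"
  by (simp add: W_def time_map_def)

lemma W_cont: "\<alpha> \<in> I \<Longrightarrow> continuous_on {0..\<alpha>} (W \<alpha>)"
  unfolding W_def[abs_def] by (rule indefinite_integral_continuous_1[OF time_map_integrable])

lemma W_deriv:
  assumes "\<alpha> \<in> I" "0 < u" "u < \<alpha>"
  shows "(W \<alpha> has_real_derivative 1 / sqrt (F \<alpha> - F u)) (at u)"
proof -
  have "isCont (\<lambda>s. 1 / sqrt (F \<alpha> - F s)) u"
    using F_less[of u \<alpha>] assms by (auto intro!: continuous_intros F_isCont simp: amplitudes_def)
  then have "((\<lambda>u. integral {0..u} (\<lambda>s. 1 / sqrt (F \<alpha> - F s))) has_vector_derivative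
      1 / sqrt (F \<alpha> - F u)) (at u within ({0..\<alpha>} - {}))"
    by (intro integral_has_vector_derivative_continuous_at time_map_integrable)
      (use assms in \<open>auto intro: continuous_at_imp_continuous_at_within\<close>)
  then show ?thesis
    unfolding has_real_derivative_iff_has_vector_derivative W_def[abs_def]
    using assms at_within_Icc_at[of 0 u \<alpha>] by simp
qed

lemma W_strict_mono:
  assumes "\<alpha> \<in> I" "0 \<le> u" "u < v" "v \<le> \<alpha>"
  shows "W \<alpha> u < W \<alpha> v"
proof (rule DERIV_pos_imp_increasing_open[OF assms(3)])
  fix x assume "u < x" "x < v"
  then show "\<exists>y. (W \<alpha> has_real_derivative y) (at x) \<and> 0 < y"
    using W_deriv[of \<alpha> x] F_less[of x \<alpha>] assms by (fastforce simp: amplitudes_def)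
qed (use assms in \<open>auto intro!: continuous_on_subset[OF W_cont[of \<alpha>]]\<close>)

text \<open>Comparing energies with a maximum point shows that the slope vanishes exactly at height
  \<alpha>. This makes the maximum point unique. Measured by \<open>W\<close>, the solution moves at
  constant speed \<open>sqrt (2 * l)\<close> on either side of it.\<close>

lemma positive_solution_time:
  assumes l: "l > 0" and sol: "positive_solution f l u"
    and \<alpha>: "\<alpha> = (SUP x\<in>{-1..1}. \<bar>u x\<bar>)" and "\<alpha> \<in> I"
  shows "time_map f \<alpha> = sqrt l"
proof -
  have cont: "continuous_on {-1..1} u" and u_pos: "\<And>x. x \<in> {-1<..<1} \<Longrightarrow> u x > 0"
    and bdry: "u (-1) = 0" "u 1 = 0"
    using sol by (auto simp: positive_solution_def)
  have u': "(u has_real_derivative deriv u x) (at x)" if "x \<in> {-1<..<1}" for x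
    using sol that by (simp add: positive_solution_def C2_on_def field_differentiable_derivI)
  have u'': "(deriv u has_real_derivative - l * f (u x)) (at x)" if "x \<in> {-1<..<1}" for x
  proof -
    have "- deriv (deriv u) x = l * f (u x)" using sol that by (simp add: positive_solution_def)
    then have "deriv (deriv u) x = - l * f (u x)" by linarith
    then show ?thesis using sol that
      by (metis positive_solution_def C2_on_def field_differentiable_derivI)
  qed
  have \<alpha>I: "\<eta> < \<alpha>" "ereal \<alpha> < \<beta>\<^sub>2" "0 < \<alpha>" using \<open>\<alpha> \<in> I\<close> \<eta>_pos by (auto simp: amplitudes_def)
  obtain x0 where x0: "x0 \<in> {-1..1}" "\<And>x. x \<in> {-1..1} \<Longrightarrow> u x \<le> u x0"
    using continuous_attains_sup[of "{-1..1}" u] cont by fastforce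
  have u_nonneg: "u x \<ge> 0" if "x \<in> {-1..1}" for x
    using u_pos[of x] bdry that by (cases "x = -1"; cases "x = 1") auto
  have "\<alpha> = u x0"
    unfolding \<alpha> by (rule cSup_eq_maximum) (use x0 u_nonneg in \<open>auto simp: image_iff intro!: bexI[of _ x0]\<close>)
  then have x0': "x0 \<in> {-1<..<1}" using x0(1) bdry \<alpha>I by (cases "x0 = -1"; cases "x0 = 1") auto
  have le: "u x \<le> \<alpha>" if "x \<in> {-1..1}" for x using x0(2)[OF that] \<open>\<alpha> = u x0\<close> by simp
  have "deriv u x0 = 0"
    by (rule DERIV_local_max[OF u'[OF x0'], of "min (1 - x0) (x0 + 1)"])
      (use x0' x0 in \<open>auto simp: abs_if split: if_splits\<close>)
  have energy: "(deriv u x)\<^sup>2 = 2 * l * (F \<alpha> - F (u x))" if x: "x \<in> {-1<..<1}" for x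
  proof -
    have "((\<lambda>x. (deriv u x)\<^sup>2 + 2 * l * F (u x)) has_real_derivative 0) (at x)"
      if "x \<in> {-1<..<1}" for x
      by (rule DERIV_cong[OF DERIV_add[OF DERIV_power[OF u''[OF that], of 2]
              DERIV_cmult[OF DERIV_chain2[OF F_deriv[OF u_pos[OF that]] u'[OF that]], of "2 * l"]]])
        simp
    then have "(deriv u x)\<^sup>2 + 2 * l * F (u x) = (deriv u x0)\<^sup>2 + 2 * l * F (u x0)"
      using DERIV_isconst3[of "-1" 1 x x0 "\<lambda>x. (deriv u x)\<^sup>2 + 2 * l * F (u x)"] x x0' by auto
    then show ?thesis using \<open>deriv u x0 = 0\<close> \<open>\<alpha> = u x0\<close> by (simp add: algebra_simps)
  qed
  have critical: "deriv u x = 0 \<longleftrightarrow> u x = \<alpha>" if "x \<in> {-1<..<1}" for x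
    using energy[OF that] F_less[of "u x" \<alpha>] u_pos[OF that] le[of x] \<alpha>I that l
    by (cases "u x = \<alpha>") auto
  \<comment> \<open>Just after a maximum point the slope turns negative, since
    \<open>- l * f \<alpha> < 0\<close>. Between two maximum points there would then be an interior
    minimum below \<alpha>, a critical point at the wrong height.\<close>
  have unique: False if pq: "p < q" "p \<in> {-1<..<1}" "q \<in> {-1<..<1}" "u p = \<alpha>" "u q = \<alpha>" for p q
  proof -
    have "- l * f (u p) < 0" using f_pos[of \<alpha>] \<alpha>I \<beta>\<^sub>1_\<eta> l pq by simp
    then obtain d where d: "d > 0" "\<And>h. 0 < h \<Longrightarrow> h < d \<Longrightarrow> deriv u (p + h) < deriv u p"
      using DERIV_neg_dec_right[OF u''[OF pq(2)]] by blast
    define k where "k = min d (q - p) / 2"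
    have k: "0 < k" "k < d" "k < q - p" using d(1) pq(1) by (auto simp: k_def min_def)
    define c where "c = p + k"
    have c: "p < c" "c < q" "deriv u c < deriv u p"
      using k d(2)[of k] by (auto simp: c_def)
    then have "deriv u c \<noteq> 0" using critical[OF pq(2)] pq(4) by auto
    then have uc: "u c < \<alpha>" using critical[of c] le[of c] c pq by auto
    have "continuous_on {p..q} u" by (rule continuous_on_subset[OF cont]) (use pq in auto)
    then obtain m where m: "m \<in> {p..q}" "\<And>x. x \<in> {p..q} \<Longrightarrow> u m \<le> u x"
      using continuous_attains_inf[of "{p..q}" u] \<open>p < q\<close> by fastforce
    have um: "u m < \<alpha>" using uc m(2)[of c] c(1,2) by simp
    then have m': "p < m" "m < q" "m \<in> {-1<..<1}"
      using m(1) pq by (cases "m = p"; cases "m = q"; auto)+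
    have "deriv u m = 0"
      by (rule DERIV_local_min[OF u'[OF m'(3)], of "min (m - p) (q - m)"])
        (use m m' in \<open>auto simp: abs_if split: if_splits\<close>)
    then show False using critical[OF m'(3)] um by simp
  qed
  have less: "u x < \<alpha>" if "x \<in> {-1<..<1}" "x \<noteq> x0" for x
  proof -
    have "u x \<noteq> \<alpha>"
    proof
      assume "u x = \<alpha>"
      then show False
        using unique[OF _ that(1) x0'] unique[OF _ x0' that(1)] that(2) \<open>\<alpha> = u x0\<close> by linarith
    qed
    then show ?thesis using le[of x] that(1) by simp
  qed
  \<comment> \<open>The derivative of \<open>W \<alpha> (u x)\<close> has modulus
    \<open>sqrt (2 * l)\<close>. Taking absolute values at one mean value point spares a discussion
    of the sign of the slope.\<close>
  have time: "\<bar>W \<alpha> (u q) - W \<alpha> (u p)\<bar> = sqrt (2 * l) * (q - p)"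
    if pq: "p < q" "-1 \<le> p" "q \<le> 1" "x0 \<notin> {p<..<q}" for p q
  proof -
    have "continuous_on {p..q} (\<lambda>x. W \<alpha> (u x))"
      by (rule continuous_on_compose2[OF W_cont[OF \<open>\<alpha> \<in> I\<close>] continuous_on_subset[OF cont]])
        (use pq le u_nonneg in auto)
    moreover have d: "((\<lambda>x. W \<alpha> (u x)) has_real_derivative 1 / sqrt (F \<alpha> - F (u x)) * deriv u x) (at x)"
      if "p < x" "x < q" for x
      by (rule DERIV_chain2[OF W_deriv u']) (use \<open>\<alpha> \<in> I\<close> u_pos[of x] less[of x] that pq in auto)
    ultimately obtain z where z: "p < z" "z < q"
      "W \<alpha> (u q) - W \<alpha> (u p) = (q - p) * (1 / sqrt (F \<alpha> - F (u z)) * deriv u z)"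
      using MVT[OF \<open>p < q\<close>, of "\<lambda>x. W \<alpha> (u x)"] by (metis (no_types) DERIV_unique real_differentiable_def)
    have gap: "F \<alpha> - F (u z) > 0" using F_less[of "u z" \<alpha>] u_pos[of z] less[of z] z pq \<alpha>I by auto
    have "\<bar>deriv u z\<bar> = sqrt (2 * l) * sqrt (F \<alpha> - F (u z))"
      using energy[of z] z pq by (metis atLeastLessThan_iff greaterThanLessThan_iff less_le_trans
          le_less_trans real_sqrt_abs real_sqrt_mult)
    then show ?thesis using z(3) gap \<open>p < q\<close> by (simp add: abs_mult)
  qed
  \<comment> \<open>Both halves cover the same distance \<open>W \<alpha> \<alpha>\<close> at the
    same speed, so they are equally long and the peak is at 0.\<close>
  have "\<bar>W \<alpha> \<alpha>\<bar> = sqrt (2 * l) * (x0 + 1)" "\<bar>W \<alpha> \<alpha>\<bar> = sqrt (2 * l) * (1 - x0)"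
    using time[of "-1" x0] time[of x0 1] x0' bdry W_0 \<open>\<alpha> = u x0\<close> by auto
  moreover from this have "x0 = 0" using l by simp
  moreover have "W \<alpha> \<alpha> > 0" using W_strict_mono[of \<alpha> 0 \<alpha>] \<open>\<alpha> \<in> I\<close> \<alpha>I W_0 by simp
  ultimately have "W \<alpha> \<alpha> = sqrt (2 * l)" by simp
  then show ?thesis by (simp add: W_amplitude real_sqrt_mult)
qed

text \<open>The inverse of \<open>W \<alpha>\<close> is the height as a function of time. Run over a
  half-interval and reflected at the peak, it is the solution.\<close>

lemma positive_solution_exists:
  assumes "\<alpha> \<in> I" "l > 0" and T: "time_map f \<alpha> = sqrt l"
  obtains u where "positive_solution f l u" "\<alpha> = (SUP x\<in>{-1..1}. \<bar>u x\<bar>)"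
proof -
  have \<alpha>I: "\<eta> < \<alpha>" "ereal \<alpha> < \<beta>\<^sub>2" "0 < \<alpha>" using \<open>\<alpha> \<in> I\<close> \<eta>_pos by (auto simp: amplitudes_def)
  define L where "L = sqrt (2 * l)"
  have L: "L > 0" "L\<^sup>2 = 2 * l" using assms(2) by (auto simp: L_def)
  have WL: "W \<alpha> \<alpha> = L" by (simp add: W_amplitude T L_def real_sqrt_mult)
  have inj: "inj_on (W \<alpha>) {0..\<alpha>}"
    by (rule linorder_inj_onI') (use W_strict_mono[OF \<open>\<alpha> \<in> I\<close>] in force)
  have img: "W \<alpha> ` {0..\<alpha>} = {0..L}"
  proof
    show "W \<alpha> ` {0..\<alpha>} \<subseteq> {0..L}"
    proof (rule image_subsetI)
      fix x assume "x \<in> {0..\<alpha>}"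
      then show "W \<alpha> x \<in> {0..L}"
        using W_strict_mono[OF \<open>\<alpha> \<in> I\<close>, of 0 x] W_strict_mono[OF \<open>\<alpha> \<in> I\<close>, of x \<alpha>] W_0[of \<alpha>] WL
        by (cases "x = 0"; cases "x = \<alpha>") auto
    qed
    show "{0..L} \<subseteq> W \<alpha> ` {0..\<alpha>}"
      using IVT'[of "W \<alpha>" 0 _ \<alpha>] W_0[of \<alpha>] WL W_cont[OF \<open>\<alpha> \<in> I\<close>] \<alpha>I by force
  qed
  define V where "V = inv_into {0..\<alpha>} (W \<alpha>)"
  have V_W: "V (W \<alpha> x) = x" if "x \<in> {0..\<alpha>}" for x using inj that by (simp add: V_def)
  have W_V: "W \<alpha> (V y) = y" and V_mem: "V y \<in> {0..\<alpha>}" if "y \<in> {0..L}" for y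
    using that f_inv_into_f[of y "W \<alpha>" "{0..\<alpha>}"] inv_into_into[of y "W \<alpha>" "{0..\<alpha>}"]
    unfolding V_def img by auto
  have V0: "V 0 = 0" and VL: "V L = \<alpha>" using V_W[of 0] V_W[of \<alpha>] W_0 WL \<alpha>I by auto
  have V_cont: "continuous_on {0..L} V"
    using continuous_on_inv[OF W_cont[OF \<open>\<alpha> \<in> I\<close>], of V] V_W img by auto
  have V_mem': "0 < V y" "V y < \<alpha>" if "0 < y" "y < L" for y
    using V_mem[of y] W_V[of y] W_0[of \<alpha>] WL that by (cases "V y = 0"; cases "V y = \<alpha>"; auto)+
  have V_deriv: "(V has_real_derivative sqrt (F \<alpha> - F (V y))) (at y)" if y: "0 < y" "y < L" for y
  proof -
    have gap: "F (V y) < F \<alpha>" using F_less[of "V y" \<alpha>] V_mem'[OF y] \<alpha>I by auto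
    have "isCont V y"
      by (rule continuous_on_interior[OF V_cont]) (use y in auto)
    then have "(V has_real_derivative inverse (1 / sqrt (F \<alpha> - F (V y)))) (at y)"
      by (intro DERIV_inverse_function[where a = 0 and b = L, OF W_deriv])
        (use y gap V_mem'[OF y] \<open>\<alpha> \<in> I\<close> W_V in auto)
    then show ?thesis by simp
  qed
  \<comment> \<open>The hypothesis on the time map says \<open>W \<alpha> \<alpha> = L\<close>, so
    the argument of \<open>V\<close> runs from 0 at the boundary to \<open>L\<close>, where
    \<open>V\<close> equals \<alpha>, at the peak.\<close>
  define u where "u = (\<lambda>x::real. V (L * (1 - \<bar>x\<bar>)))"
  \<comment> \<open>The slope dictated by the energy identity; its value at the peak is 0, the limit
    from both sides.\<close>
  define u1 where "u1 = (\<lambda>x. - sgn x * L * sqrt (F \<alpha> - F (u x)))"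
  have arg: "L * (1 - \<bar>x\<bar>) \<in> {0..L}" if "x \<in> {-1..1}" for x
    using that L(1) by (auto simp: abs_if mult_le_cancel_left1)
  have arg': "0 < L * (1 - \<bar>x\<bar>)" "L * (1 - \<bar>x\<bar>) < L" if "x \<in> {-1<..<1}" "x \<noteq> 0" for x
    using that L(1) by (auto simp: abs_if mult_less_cancel_left1)
  have u_cont: "continuous_on {-1..1} u"
    unfolding u_def
    by (rule continuous_on_compose2[OF V_cont]) (use arg in \<open>auto intro!: continuous_intros\<close>)
  have u_isCont: "isCont u x" if "x \<in> {-1<..<1}" for x
    by (rule continuous_on_interior[OF u_cont]) (use that in auto)
  have u0: "u 0 = \<alpha>" and u_bdry: "u (-1) = 0" "u 1 = 0" by (simp_all add: u_def VL V0)
  have u_mem: "u x \<in> {0..\<alpha>}" if "x \<in> {-1..1}" for x using V_mem[OF arg[OF that]] by (simp add: u_def)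
  have u_mem': "0 < u x" "u x < \<alpha>" if "x \<in> {-1<..<1}" "x \<noteq> 0" for x
    using V_mem'[OF arg'[OF that]] by (auto simp: u_def)
  have u_pos: "0 < u x" if "x \<in> {-1<..<1}" for x using u_mem'(1)[OF that] u0 \<alpha>I by (cases "x = 0") auto
  have abs_deriv: "(abs has_real_derivative sgn x) (at x)" if "x \<noteq> 0" for x :: real
  proof (cases "x > 0")
    case True
    show ?thesis
      by (rule has_field_derivative_transform_within_open[of "\<lambda>x. x" _ _ "{0<..}"]) (use True in auto)
  next
    case False
    show ?thesis
      by (rule has_field_derivative_transform_within_open[of "\<lambda>x. - x" _ _ "{..<0}"])
        (use False that in \<open>auto intro!: derivative_eq_intros\<close>)
  qed
  have du: "(u has_real_derivative u1 x) (at x)" if x: "x \<in> {-1<..<1}" "x \<noteq> 0" for x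
    unfolding u_def
    by (rule DERIV_cong[OF DERIV_chain2[OF V_deriv[OF arg'[OF x]]
            DERIV_cmult[OF DERIV_diff[OF DERIV_const abs_deriv[OF x(2)]]]]])
      (simp add: u1_def u_def)
  have du1: "(u1 has_real_derivative - l * f (u x)) (at x)" if x: "x \<in> {-1<..<1}" "x \<noteq> 0" for x
  proof -
    define q where "q = sqrt (F \<alpha> - F (u x))"
    have gap: "0 < F \<alpha> - F (u x)" using F_less[OF u_mem'[OF x]] \<alpha>I by simp
    then have "q \<noteq> 0" by (simp add: q_def)
    have "((\<lambda>y. - sgn x * L * sqrt (F \<alpha> - F (u y))) has_real_derivative
        - sgn x * L * (- (f (u x) * u1 x) * (inverse q / 2))) (at x)"
      unfolding q_def using gap
      by (auto intro!: derivative_eq_intros DERIV_chain2[OF F_deriv du[OF x]] u_pos[OF x(1)])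
    moreover have "- sgn x * L * (- (f (u x) * u1 x) * (inverse q / 2)) = - l * f (u x)"
      using \<open>q \<noteq> 0\<close> L(2) x(2) unfolding u1_def q_def[symmetric]
      by (cases "x > 0") (auto simp: field_simps power2_eq_square)
    ultimately have "((\<lambda>y. - sgn x * L * sqrt (F \<alpha> - F (u y))) has_real_derivative - l * f (u x)) (at x)"
      by simp
    moreover have "open (if 0 < x then {0<..} else {..<0::real})" by simp
    ultimately show ?thesis
      by (rule has_field_derivative_transform_within_open) (use x in \<open>auto simp: u1_def split: if_splits\<close>)
  qed
  have near: "\<forall>\<^sub>F x in at 0. x \<in> {-1<..<1} \<and> x \<noteq> (0::real)"
    by (rule eventually_conj[OF eventually_at_in_open'[of "{-1<..<1}"]])
      (auto simp: eventually_at intro!: exI[of _ 1])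
  have u1_cont0: "isCont u1 0"
  proof -
    have "isCont (\<lambda>x. L * sqrt (F \<alpha> - F (u x))) 0"
      by (intro continuous_intros isCont_o2[OF u_isCont F_isCont]) (use u0 \<alpha>I in auto)
    then have "((\<lambda>x. \<bar>L * sqrt (F \<alpha> - F (u x))\<bar>) \<longlongrightarrow> 0) (at 0)"
      by (intro tendsto_rabs_zero) (simp add: isCont_def u0)
    then have "(u1 \<longlongrightarrow> 0) (at 0)"
      by (rule Lim_null_comparison[rotated])
        (auto intro!: always_eventually simp: u1_def abs_mult abs_sgn_eq)
    then show ?thesis by (simp add: isCont_def u1_def)
  qed
  have fu_cont: "isCont (\<lambda>x. - l * f (u x)) x" if "x \<in> {-1<..<1}" for x
    by (intro continuous_intros isCont_o2[OF u_isCont f_cont]) (use u_pos that in auto)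
  have Du: "(u has_real_derivative u1 x) (at x)" if "x \<in> {-1<..<1}" for x
  proof (cases "x = 0")
    case True
    have "(u has_real_derivative u1 0) (at 0)"
      by (rule has_real_derivative_by_continuity[OF u_isCont u1_cont0])
        (use near in \<open>auto elim!: eventually_mono intro: du\<close>)
    then show ?thesis using True by simp
  qed (use du that in auto)
  have Du1: "(u1 has_real_derivative - l * f (u x)) (at x)" if "x \<in> {-1<..<1}" for x
  proof (cases "x = 0")
    case True
    have "(u1 has_real_derivative - l * f (u 0)) (at 0)"
      by (rule has_real_derivative_by_continuity[OF u1_cont0 fu_cont])
        (use near in \<open>auto elim!: eventually_mono intro: du1[simplified]\<close>)
    then show ?thesis using True by simp
  qed (use du1 that in auto)
  have deriv_u: "deriv u x = u1 x" if "x \<in> {-1<..<1}" for x by (rule DERIV_imp_deriv[OF Du[OF that]])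
  have DDu: "(deriv u has_real_derivative - l * f (u x)) (at x)" if "x \<in> {-1<..<1}" for x
    by (rule has_field_derivative_transform_within_open[OF Du1[OF that], of "{-1<..<1}"])
      (use that deriv_u in auto)
  have deriv2_u: "deriv (deriv u) x = - l * f (u x)" if "x \<in> {-1<..<1}" for x
    by (rule DERIV_imp_deriv[OF DDu[OF that]])
  have "continuous_on {-1<..<1} (deriv (deriv u))"
    by (subst continuous_on_cong[OF refl deriv2_u])
      (auto intro!: continuous_at_imp_continuous_on fu_cont[simplified])
  then have "C2_on {-1<..<1} u"
    unfolding C2_on_def using Du DDu by (meson field_differentiable_def)
  then have "positive_solution f l u"
    unfolding positive_solution_def using u_cont deriv2_u u_pos u_bdry by auto
  moreover have "\<alpha> = (SUP x\<in>{-1..1}. \<bar>u x\<bar>)"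
    by (rule cSup_eq_maximum[symmetric]) (use u_mem u0 \<alpha>I in \<open>auto simp: image_iff intro!: bexI[of _ 0]\<close>)
  ultimately show ?thesis using that by blast
qed

lemma bifurcation_curve_described: "described_by (bifurcation_curve f) (time_map f) I"
  unfolding described_by_def
proof (intro set_eqI iffI)
  fix z assume "z \<in> bifurcation_curve f \<inter> UNIV \<times> I"
  then show "z \<in> {(l, \<alpha>). 0 < l \<and> \<alpha> \<in> I \<and> time_map f \<alpha> = sqrt l}"
    using positive_solution_time by (auto simp: bifurcation_curve_def)
next
  fix z assume "z \<in> {(l, \<alpha>). 0 < l \<and> \<alpha> \<in> I \<and> time_map f \<alpha> = sqrt l}"
  then obtain l \<alpha> where z: "z = (l, \<alpha>)" "0 < l" "\<alpha> \<in> I" "time_map f \<alpha> = sqrt l" by auto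
  then obtain u where "positive_solution f l u" "\<alpha> = (SUP x\<in>{-1..1}. \<bar>u x\<bar>)"
    using positive_solution_exists by blast
  then show "z \<in> bifurcation_curve f \<inter> UNIV \<times> I"
    using z by (auto simp: bifurcation_curve_def)
qed

end

section \<open>Improper integrals and valley-shaped functions\<close>

lemma improper_integral_cong:
  assumes "\<And>x. a < x \<Longrightarrow> x < b \<Longrightarrow> h x = k x"
  shows "improper_integral a b h = improper_integral a b k"
proof -
  have "\<forall>\<^sub>F z in at_right a \<times>\<^sub>F at_left b. a < fst z \<and> snd z < b"
    by (intro eventually_prodI) (auto simp: eventually_at_filter)
  then have "\<forall>\<^sub>F z in at_right a \<times>\<^sub>F at_left b.
      (case z of (s, t) \<Rightarrow> ereal (integral {s..t} h)) = (case z of (s, t) \<Rightarrow> ereal (integral {s..t} k))"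
    by eventually_elim (auto intro!: integral_cong assms)
  from tendsto_cong[OF this] show ?thesis
    by (simp add: improper_integral_def Topological_Spaces.Lim_def)
qed

lemma integral_tendsto_endpoints:
  fixes k :: "real \<Rightarrow> real"
  assumes "a < b" "k integrable_on {a..b}"
  shows "((\<lambda>(s, t). integral {s..t} k) \<longlongrightarrow> integral {a..b} k) (at_right a \<times>\<^sub>F at_left b)"
proof -
  define K where "K = (\<lambda>t. integral {a..t} k)"
  have "continuous_on {a..b} K"
    unfolding K_def by (rule indefinite_integral_continuous_1[OF assms(2)])
  then have K: "(K \<longlongrightarrow> K a) (at_right a)" "(K \<longlongrightarrow> K b) (at_left b)"
    using assms(1) by (auto intro: continuous_on_Icc_at_rightD continuous_on_Icc_at_leftD)
  have "((\<lambda>z. K (snd z) - K (fst z)) \<longlongrightarrow> K b - K a) (at_right a \<times>\<^sub>F at_left b)"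
    by (intro tendsto_diff filterlim_compose[OF K(1) filterlim_fst] filterlim_compose[OF K(2) filterlim_snd])
  moreover have "\<forall>\<^sub>F s in at_right a. a < s \<and> s < (a+b)/2" "\<forall>\<^sub>F t in at_left b. (a+b)/2 < t \<and> t < b"
    using assms(1) by (auto intro!: eventually_at_rightI[of a "(a+b)/2"] eventually_at_leftI[of "(a+b)/2"])
  then have "\<forall>\<^sub>F z in at_right a \<times>\<^sub>F at_left b.
      K (snd z) - K (fst z) = (case z of (s, t) \<Rightarrow> integral {s..t} k)"
  proof (elim eventually_mono[OF eventually_prodI])
    fix z assume "(a < fst z \<and> fst z < (a+b)/2) \<and> (a+b)/2 < snd z \<and> snd z < b"
    then have z: "a \<le> fst z" "fst z \<le> snd z" "snd z \<le> b" by auto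
    then have "integral {a..fst z} k + integral {fst z..snd z} k = integral {a..snd z} k"
      by (intro Henstock_Kurzweil_Integration.integral_combine)
        (auto intro: integrable_on_subinterval[OF assms(2)])
    then show "K (snd z) - K (fst z) = (case z of (s, t) \<Rightarrow> integral {s..t} k)"
      by (simp add: K_def case_prod_beta)
  qed
  ultimately have "((\<lambda>z. case z of (s, t) \<Rightarrow> integral {s..t} k) \<longlongrightarrow> K b - K a) (at_right a \<times>\<^sub>F at_left b)"
    by (rule Lim_transform_eventually)
  then show ?thesis by (simp add: K_def)
qed

lemma improper_integral_eq_integral:
  assumes "a < b" "h integrable_on {a..b}"
  shows "improper_integral a b h = ereal (integral {a..b} h)"
  unfolding improper_integral_def
proof (rule tendsto_Lim)
  show "at_right a \<times>\<^sub>F at_left b \<noteq> bot" by (simp add: prod_filter_eq_bot)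
  show "((\<lambda>(s, t). ereal (integral {s..t} h)) \<longlongrightarrow> ereal (integral {a..b} h)) (at_right a \<times>\<^sub>F at_left b)"
    using tendsto_ereal[OF integral_tendsto_endpoints[OF assms]] by (simp add: case_prod_beta')
qed

text \<open>Strictness must survive the limit even when the left side is -\<infinity>. As
  \<open>k - h\<close> is positive, its integrals over growing intervals increase to their supremum
  \<open>X\<close>, finite or not, and the left side is the integral of \<open>k\<close> minus
  \<open>X\<close>. One compact subinterval keeps \<open>X\<close> above 0.\<close>

lemma improper_integral_less:
  assumes "a < b" "continuous_on {a<..<b} h" "continuous_on {a<..<b} k" "k integrable_on {a..b}"
    and less: "\<And>x. a < x \<Longrightarrow> x < b \<Longrightarrow> h x < k x"
  shows "improper_integral a b h < ereal (integral {a..b} k)"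
proof -
  define g where "g = (\<lambda>x. k x - h x)"
  have g_cont: "continuous_on {a<..<b} g" unfolding g_def by (intro continuous_intros assms)
  have g_pos: "g x > 0" if "a < x" "x < b" for x using less[OF that] by (simp add: g_def)
  have g_int: "g integrable_on {s..t}" and h_int: "h integrable_on {s..t}"
    if "a < s" "t < b" for s t
    by (rule integrable_continuous_real; rule continuous_on_subset[OF g_cont] continuous_on_subset[OF assms(2)];
        use that in auto)+
  define R where "R = {(s, t). a < s \<and> s < t \<and> t < b}"
  define X where "X = (SUP z\<in>R. ereal (integral {fst z..snd z} g))"
  have "\<forall>\<^sub>F s in at_right a. a < s \<and> s < (a+b)/2" "\<forall>\<^sub>F t in at_left b. (a+b)/2 < t \<and> t < b"
    using assms(1) by (auto intro!: eventually_at_rightI[of a "(a+b)/2"] eventually_at_leftI[of "(a+b)/2"])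
  then have ev: "\<forall>\<^sub>F z in at_right a \<times>\<^sub>F at_left b. z \<in> R"
    by (auto simp: R_def elim!: eventually_mono[OF eventually_prodI])
  have "((\<lambda>z. ereal (integral {fst z..snd z} g)) \<longlongrightarrow> X) (at_right a \<times>\<^sub>F at_left b)"
  proof (rule order_tendstoI)
    fix y assume "y < X"
    then obtain s0 t0 where st: "a < s0" "s0 < t0" "t0 < b" "y < ereal (integral {s0..t0} g)"
      unfolding X_def less_SUP_iff by (auto simp: R_def)
    have "\<forall>\<^sub>F s in at_right a. a < s \<and> s < s0" "\<forall>\<^sub>F t in at_left b. t0 < t \<and> t < b"
      using st by (auto intro!: eventually_at_rightI[of a s0] eventually_at_leftI[of t0])
    then show "\<forall>\<^sub>F z in at_right a \<times>\<^sub>F at_left b. y < ereal (integral {fst z..snd z} g)"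
    proof (elim eventually_mono[OF eventually_prodI])
      fix z assume z: "(a < fst z \<and> fst z < s0) \<and> t0 < snd z \<and> snd z < b"
      have "integral {s0..t0} g \<le> integral {fst z..snd z} g"
        by (rule integral_subset_le) (use z st in \<open>auto intro!: g_int less_imp_le[OF g_pos]\<close>)
      then show "y < ereal (integral {fst z..snd z} g)"
        using st(4) by (metis ereal_less_eq(3) order_less_le_trans)
    qed
  next
    fix y assume "X < y"
    show "\<forall>\<^sub>F z in at_right a \<times>\<^sub>F at_left b. ereal (integral {fst z..snd z} g) < y"
      using ev
    proof eventually_elim
      fix z assume "z \<in> R"
      then have "ereal (integral {fst z..snd z} g) \<le> X" unfolding X_def by (rule SUP_upper)
      then show "ereal (integral {fst z..snd z} g) < y" using \<open>X < y\<close> by simp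
    qed
  qed
  moreover have "((\<lambda>z. ereal (integral {fst z..snd z} k)) \<longlongrightarrow> ereal (integral {a..b} k)) (at_right a \<times>\<^sub>F at_left b)"
    using tendsto_ereal[OF integral_tendsto_endpoints[OF assms(1,4)]] by (simp add: case_prod_beta')
  ultimately have "((\<lambda>z. ereal (integral {fst z..snd z} k) + - ereal (integral {fst z..snd z} g))
      \<longlongrightarrow> ereal (integral {a..b} k) + - X) (at_right a \<times>\<^sub>F at_left b)"
    by (intro tendsto_add_ereal_general2 tendsto_uminus_ereal) auto
  moreover have "\<forall>\<^sub>F z in at_right a \<times>\<^sub>F at_left b.
      ereal (integral {fst z..snd z} k) + - ereal (integral {fst z..snd z} g)
      = (case z of (s, t) \<Rightarrow> ereal (integral {s..t} h))"
    using ev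
  proof eventually_elim
    fix z assume z: "z \<in> R"
    have "integral {fst z..snd z} (\<lambda>x. g x + h x) = integral {fst z..snd z} g + integral {fst z..snd z} h"
      by (rule integral_add) (use z in \<open>auto simp: R_def intro!: g_int h_int\<close>)
    then show "ereal (integral {fst z..snd z} k) + - ereal (integral {fst z..snd z} g)
      = (case z of (s, t) \<Rightarrow> ereal (integral {s..t} h))"
      by (simp add: g_def case_prod_beta)
  qed
  ultimately have "((\<lambda>(s, t). ereal (integral {s..t} h)) \<longlongrightarrow> ereal (integral {a..b} k) + - X)
      (at_right a \<times>\<^sub>F at_left b)"
    by (rule Lim_transform_eventually)
  then have "improper_integral a b h = ereal (integral {a..b} k) + - X"
    unfolding improper_integral_def by (intro tendsto_Lim) (simp add: prod_filter_eq_bot)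
  moreover have "0 < X"
  proof -
    define c d where "c = (2*a+b)/3" and "d = (a+2*b)/3"
    have cd: "a < c" "c < d" "d < b" using \<open>a < b\<close> by (auto simp: c_def d_def field_simps)
    have "0 < integral {c..d} g"
      by (rule integral_pos_real)
        (use cd in \<open>auto intro!: g_int g_pos continuous_on_subset[OF g_cont]\<close>)
    also have "ereal (integral {c..d} g) \<le> X"
      unfolding X_def by (rule SUP_upper2[of "(c, d)"]) (use cd in \<open>auto simp: R_def\<close>)
    finally show ?thesis by (simp add: zero_ereal_def)
  qed
  ultimately show ?thesis by (cases X) auto
qed

text \<open>The hypothesis \<open>turn\<close> is what strict convexity in some reparametrisation of the line leaves.\<close>

lemma valley_shape:
  fixes T :: "real \<Rightarrow> real"
  assumes "open I" "is_interval I" and cont: "continuous_on I T"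
    and turn: "\<And>x y z. x \<in> I \<Longrightarrow> y \<in> I \<Longrightarrow> z \<in> I \<Longrightarrow> x < y \<Longrightarrow> y < z \<Longrightarrow> T z \<le> T y \<Longrightarrow> T y < T x"
    and "\<alpha>\<^sub>1 \<in> I" and incr: "strict_mono_on {\<alpha>\<in>I. \<alpha>\<^sub>1 \<le> \<alpha>} T"
    and "\<not> strict_mono_on I T"
  shows "\<exists>\<alpha>\<^sub>0\<in>I. strict_antimono_on {\<alpha>\<in>I. \<alpha> \<le> \<alpha>\<^sub>0} T \<and> strict_mono_on {\<alpha>\<in>I. \<alpha>\<^sub>0 \<le> \<alpha>} T"
proof -
  have mem: "z \<in> I" if "x \<in> I" "y \<in> I" "x \<le> z" "z \<le> y" for x y z
    using assms(2) that unfolding is_interval_1 by blast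
  \<comment> \<open>The points from which \<open>T\<close> fails to rise strictly to all later
    values. Failure of monotonicity makes \<open>A\<close> nonempty, \<open>\<alpha>\<^sub>1\<close>
    bounds it, and its supremum is the turning point.\<close>
  define A where "A = {x\<in>I. \<exists>y\<in>I. x < y \<and> T y \<le> T x}"
  obtain x1 where x1: "x1 \<in> A"
    using assms(7) by (force simp: A_def monotone_on_def)
  have A_le: "x \<le> \<alpha>\<^sub>1" if x: "x \<in> A" for x
  proof (rule ccontr)
    assume "\<not> x \<le> \<alpha>\<^sub>1"
    moreover obtain y where "x \<in> I" "y \<in> I" "x < y" "T y \<le> T x" using x by (auto simp: A_def)
    ultimately show False using incr by (force simp: monotone_on_def)
  qed
  then have bdd: "bdd_above A" by (rule bdd_aboveI)
  define \<alpha>\<^sub>0 where "\<alpha>\<^sub>0 = Sup A"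
  have "x1 \<le> \<alpha>\<^sub>0" unfolding \<alpha>\<^sub>0_def by (rule cSup_upper[OF x1 bdd])
  moreover have "\<alpha>\<^sub>0 \<le> \<alpha>\<^sub>1" unfolding \<alpha>\<^sub>0_def by (rule cSup_least) (use x1 A_le in auto)
  moreover have "x1 \<in> I" using x1 by (simp add: A_def)
  ultimately have "\<alpha>\<^sub>0 \<in> I" using mem[OF _ \<open>\<alpha>\<^sub>1 \<in> I\<close>] by blast
  \<comment> \<open>Some \<open>z\<close> in \<open>A\<close> lies beyond \<open>y\<close>; the
    descent it witnesses is passed to the left twice by \<open>turn\<close>, from \<open>z\<close>
    to \<open>y\<close> and from \<open>y\<close> to \<open>x\<close>.\<close>
  have dec: "T y < T x" if xy: "x \<in> I" "y \<in> I" "x < y" "y < \<alpha>\<^sub>0" for x y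
  proof -
    obtain z where z: "z \<in> A" "y < z"
      using less_cSupD[of A y] \<open>y < \<alpha>\<^sub>0\<close> x1 unfolding \<alpha>\<^sub>0_def by auto
    then obtain z' where "z' \<in> I" "z \<in> I" "z < z'" "T z' \<le> T z" by (auto simp: A_def)
    then have "T z < T y" using turn[OF \<open>y \<in> I\<close> \<open>z \<in> I\<close> \<open>z' \<in> I\<close> \<open>y < z\<close>] by simp
    then show ?thesis
      using turn[OF \<open>x \<in> I\<close> \<open>y \<in> I\<close> \<open>z \<in> I\<close> \<open>x < y\<close> \<open>y < z\<close>] by simp
  qed
  have inc: "T x < T y" if xy: "x \<in> I" "y \<in> I" "x < y" "\<alpha>\<^sub>0 < x" for x y
  proof (rule ccontr)
    assume "\<not> T x < T y"
    then have "x \<in> A" using xy by (auto simp: A_def)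
    then show False using cSup_upper[OF _ bdd] xy unfolding \<alpha>\<^sub>0_def by force
  qed
  have "isCont T \<alpha>\<^sub>0" using cont \<open>open I\<close> \<open>\<alpha>\<^sub>0 \<in> I\<close> by (simp add: continuous_on_eq_continuous_at)
  then have lim: "(T \<longlongrightarrow> T \<alpha>\<^sub>0) (at_left \<alpha>\<^sub>0)" "(T \<longlongrightarrow> T \<alpha>\<^sub>0) (at_right \<alpha>\<^sub>0)"
    by (auto simp: isCont_def filterlim_at_split)
  \<comment> \<open>So far the inequalities avoid \<open>\<alpha>\<^sub>0\<close> itself. One-sided
    limits give weak inequalities there, and an intermediate point makes them strict again
    below.\<close>
  have le_left: "T \<alpha>\<^sub>0 \<le> T m" if "m \<in> I" "m < \<alpha>\<^sub>0" for m
  proof (rule tendsto_upperbound[OF lim(1)])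
    show "\<forall>\<^sub>F i in at_left \<alpha>\<^sub>0. T i \<le> T m"
      by (rule eventually_at_leftI[OF _ \<open>m < \<alpha>\<^sub>0\<close>])
        (use dec[OF that(1)] mem[OF that(1) \<open>\<alpha>\<^sub>0 \<in> I\<close>] in \<open>simp add: less_imp_le\<close>)
  qed simp
  have le_right: "T \<alpha>\<^sub>0 \<le> T m" if "m \<in> I" "\<alpha>\<^sub>0 < m" for m
  proof (rule tendsto_upperbound[OF lim(2)])
    show "\<forall>\<^sub>F i in at_right \<alpha>\<^sub>0. T i \<le> T m"
      by (rule eventually_at_rightI[OF _ \<open>\<alpha>\<^sub>0 < m\<close>])
        (use inc[OF _ that(1)] mem[OF \<open>\<alpha>\<^sub>0 \<in> I\<close> that(1)] in \<open>simp add: less_imp_le\<close>)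
  qed simp
  have "T y < T x" if xy: "x \<in> I" "y \<in> I" "x < y" "y \<le> \<alpha>\<^sub>0" for x y
  proof (cases "y = \<alpha>\<^sub>0")
    case True
    obtain m where m: "x < m" "m < y" using dense[OF \<open>x < y\<close>] by blast
    then have "m \<in> I" using mem[of x y m] xy by auto
    then show ?thesis using dec[OF xy(1), of m] le_left[of m] m True by simp
  qed (use dec xy in auto)
  moreover have "T x < T y" if xy: "x \<in> I" "y \<in> I" "x < y" "\<alpha>\<^sub>0 \<le> x" for x y
  proof (cases "x = \<alpha>\<^sub>0")
    case True
    obtain m where m: "x < m" "m < y" using dense[OF \<open>x < y\<close>] by blast
    then have "m \<in> I" using mem[of x y m] xy by auto
    then show ?thesis using inc[OF _ xy(2), of m] le_right[of m] m True by simp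
  qed (use inc xy in auto)
  ultimately show ?thesis
    using \<open>\<alpha>\<^sub>0 \<in> I\<close> by (intro bexI[of _ \<alpha>\<^sub>0]) (auto simp: monotone_on_def)
qed

section \<open>The rescaled time map integrand\<close>

context time_map_problem
begin

definition \<theta> :: "real \<Rightarrow> real" where
  "\<theta> u = 2 * F u - u * f u"

definition d\<theta> :: "real \<Rightarrow> real" where
  "d\<theta> u = f u - u * deriv f u"

definition E :: "real \<Rightarrow> real \<Rightarrow> real" where
  "E \<alpha> v = F \<alpha> - F (\<alpha> * v / \<eta>)"

text \<open>Rescaling the time map integral to the interval \<open>(0, \<eta>)\<close> makes its integrand at
  \<open>\<alpha> = \<eta>\<close> match the one of \<open>G\<close>.\<close>

definition N :: "real \<Rightarrow> real \<Rightarrow> real" where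
  "N \<alpha> v = \<alpha> / sqrt (E \<alpha> v)"

definition dN :: "real \<Rightarrow> real \<Rightarrow> real" where
  "dN \<alpha> v = (\<theta> \<alpha> - \<theta> (\<alpha> * v / \<eta>)) / (2 * (E \<alpha> v * sqrt (E \<alpha> v)))"

lemma scaled_mem: "0 < v \<Longrightarrow> v < \<eta> \<Longrightarrow> 0 < \<alpha> \<Longrightarrow> 0 < \<alpha> * v / \<eta> \<and> \<alpha> * v / \<eta> < \<alpha>"
  using \<eta>_pos by (simp add: field_simps)

lemma E_pos:
  assumes "\<eta> \<le> \<alpha>" "ereal \<alpha> < \<beta>\<^sub>2" "0 < v" "v < \<eta>"
  shows "0 < E \<alpha> v"
  using F_less[of "\<alpha> * v / \<eta>" \<alpha>] scaled_mem[of v \<alpha>] assms \<eta>_pos by (simp add: E_def)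

lemma \<theta>_deriv: "0 < u \<Longrightarrow> (\<theta> has_real_derivative d\<theta> u) (at u)"
  unfolding \<theta>_def[abs_def] d\<theta>_def by (auto intro!: derivative_eq_intros F_deriv f_deriv)

lemma \<theta>_isCont: "0 < u \<Longrightarrow> isCont \<theta> u"
  using \<theta>_deriv DERIV_isCont by blast

lemma E_deriv:
  assumes "0 < \<alpha>" "0 < v"
  shows "((\<lambda>\<alpha>. E \<alpha> v) has_real_derivative f \<alpha> - f (\<alpha> * v / \<eta>) * (v / \<eta>)) (at \<alpha>)"
proof -
  have "((\<lambda>\<alpha>. \<alpha> * v / \<eta>) has_real_derivative v / \<eta>) (at \<alpha>)"
    using \<eta>_pos by (auto intro!: derivative_eq_intros)
  then show ?thesis
    unfolding E_def using assms \<eta>_pos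
    by (intro DERIV_diff F_deriv DERIV_chain2[OF F_deriv]) auto
qed

lemma N_deriv:
  assumes "\<eta> \<le> \<alpha>" "ereal \<alpha> < \<beta>\<^sub>2" "0 < v" "v < \<eta>"
  shows "((\<lambda>\<alpha>. N \<alpha> v) has_real_derivative dN \<alpha> v) (at \<alpha>)"
proof -
  have E: "0 < E \<alpha> v" and \<alpha>: "0 < \<alpha>" using E_pos assms \<eta>_pos by auto
  define q where "q = sqrt (E \<alpha> v)"
  have q: "0 < q" "E \<alpha> v = q * q" using E by (auto simp: q_def)
  define w where "w = \<alpha> * v / \<eta>"
  have vw: "v / \<eta> = w / \<alpha>" using \<alpha> by (simp add: w_def)
  have "((\<lambda>\<alpha>. \<alpha> / sqrt (E \<alpha> v)) has_real_derivative
      (1 * q - \<alpha> * ((f \<alpha> - f w * (v / \<eta>)) * (inverse q / 2))) / (q * q)) (at \<alpha>)"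
    using E unfolding q_def w_def
    by (intro DERIV_divide DERIV_ident DERIV_chain2[OF DERIV_real_sqrt E_deriv, unfolded mult.commute[of "inverse _ / 2"]])
      (use assms \<alpha> in auto)
  moreover have "(1 * q - \<alpha> * ((f \<alpha> - f w * (v / \<eta>)) * (inverse q / 2))) / (q * q)
      = (\<theta> \<alpha> - \<theta> w) / (2 * (q * q * q))"
  proof -
    have "\<theta> \<alpha> - \<theta> w = 2 * (q * q) - (\<alpha> * f \<alpha> - w * f w)"
      using q(2) by (simp add: \<theta>_def E_def w_def algebra_simps)
    then show ?thesis using q(1) \<alpha> unfolding vw by (simp only:) (simp add: field_simps)
  qed
  moreover have "dN \<alpha> v = (\<theta> \<alpha> - \<theta> w) / (2 * (q * q * q))"
    using q(2) q_def unfolding dN_def w_def by metis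
  ultimately show ?thesis unfolding N_def[abs_def] by simp
qed

lemma N_cont:
  assumes "\<eta> \<le> \<alpha>" "ereal \<alpha> < \<beta>\<^sub>2"
  shows "continuous_on {0<..<\<eta>} (N \<alpha>)" "continuous_on {0<..<\<eta>} (dN \<alpha>)"
proof -
  have 1: "continuous_on {0<..<\<eta>} (\<lambda>v. F (\<alpha> * v / \<eta>))" "continuous_on {0<..<\<eta>} (\<lambda>v. \<theta> (\<alpha> * v / \<eta>))"
    using assms \<eta>_pos
    by (auto intro!: continuous_at_imp_continuous_on continuous_intros isCont_o2[OF _ F_isCont]
        isCont_o2[OF _ \<theta>_isCont])
  have E: "0 < E \<alpha> v" if "v \<in> {0<..<\<eta>}" for v using E_pos[OF assms] that by auto
  then have ne: "\<forall>v\<in>{0<..<\<eta>}. sqrt (E \<alpha> v) \<noteq> 0"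
    "\<forall>v\<in>{0<..<\<eta>}. 2 * (E \<alpha> v * sqrt (E \<alpha> v)) \<noteq> 0" by fastforce+
  have 2: "continuous_on {0<..<\<eta>} (E \<alpha>)" unfolding E_def by (intro continuous_intros 1)
  show "continuous_on {0<..<\<eta>} (N \<alpha>)" "continuous_on {0<..<\<eta>} (dN \<alpha>)"
    unfolding N_def dN_def by (intro continuous_intros 1 2 ne)+
qed

lemma N_has_integral:
  assumes "\<alpha> \<in> I"
  shows "(N \<alpha> has_integral sqrt 2 * \<eta> * time_map f \<alpha>) {0..\<eta>}"
proof -
  have \<alpha>: "\<eta> < \<alpha>" "0 < \<alpha>" using assms \<eta>_pos by (auto simp: amplitudes_def)
  define m where "m = \<alpha> / \<eta>"
  have m: "0 < m" "\<alpha> = m * \<eta>" using \<alpha> \<eta>_pos by (auto simp: m_def)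
  have "((\<lambda>u. 1 / sqrt (F \<alpha> - F u)) has_integral sqrt 2 * time_map f \<alpha>) {0..\<alpha>}"
    using integrable_integral[OF time_map_integrable[OF assms]] by (simp add: time_map_def)
  from has_integral_stretch_real[OF this, of m]
  have "((\<lambda>v. 1 / sqrt (F \<alpha> - F (m * v))) has_integral (1 / m) * (sqrt 2 * time_map f \<alpha>)) ((\<lambda>x. x / m) ` {0..\<alpha>})"
    using m by simp
  moreover have "(\<lambda>x. x / m) ` {0..\<alpha>} = {0..\<eta>}"
    using m by (auto simp: image_iff field_simps intro!: bexI[of _ "m * _"])
  ultimately have "((\<lambda>v. \<alpha> * (1 / sqrt (F \<alpha> - F (m * v)))) has_integral \<alpha> * ((1 / m) * (sqrt 2 * time_map f \<alpha>))) {0..\<eta>}"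
    by (intro has_integral_mult_right) simp
  moreover have "(\<lambda>v. \<alpha> * (1 / sqrt (F \<alpha> - F (m * v)))) = N \<alpha>"
    by (simp add: N_def[abs_def] E_def m_def)
  moreover have "\<alpha> * ((1 / m) * (sqrt 2 * time_map f \<alpha>)) = sqrt 2 * \<eta> * time_map f \<alpha>"
    using m(1) unfolding m(2) by simp
  ultimately show ?thesis by simp
qed

lemma N_integrable: "\<alpha> \<in> I \<Longrightarrow> N \<alpha> integrable_on {0..\<eta>}"
  and N_integral: "\<alpha> \<in> I \<Longrightarrow> integral {0..\<eta>} (N \<alpha>) = sqrt 2 * \<eta> * time_map f \<alpha>"
  using N_has_integral by blast+

lemma time_map_less:
  assumes "x \<in> I" "y \<in> I" "\<And>v. 0 < v \<Longrightarrow> v < \<eta> \<Longrightarrow> N x v < N y v"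
  shows "time_map f x < time_map f y"
proof -
  have "integral {0..\<eta>} (N x) < integral {0..\<eta>} (N y)"
    by (rule integral_strict_mono_real)
      (use assms \<eta>_pos N_integrable N_cont in \<open>auto simp: amplitudes_def\<close>)
  then show ?thesis using N_integral assms \<eta>_pos by simp
qed

lemma dN_pos:
  assumes "\<eta> \<le> \<alpha>" "ereal \<alpha> < \<beta>\<^sub>2" "0 < v" "v < \<eta>" "\<theta> (\<alpha> * v / \<eta>) < \<theta> \<alpha>"
  shows "0 < dN \<alpha> v"
  using E_pos[OF assms(1-4)] assms(5) by (simp add: dN_def)

lemma dN_neg:
  assumes "\<eta> \<le> \<alpha>" "ereal \<alpha> < \<beta>\<^sub>2" "0 < v" "v < \<eta>" "\<theta> \<alpha> < \<theta> (\<alpha> * v / \<eta>)"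
  shows "dN \<alpha> v < 0"
  using E_pos[OF assms(1-4)] assms(5) by (simp add: dN_def divide_neg_pos)

lemma time_map_increasing:
  assumes "\<eta> < x" "x < y" "ereal y < \<beta>\<^sub>2"
    and \<theta>: "\<And>\<alpha> w. x \<le> \<alpha> \<Longrightarrow> \<alpha> \<le> y \<Longrightarrow> 0 < w \<Longrightarrow> w < \<alpha> \<Longrightarrow> \<theta> w < \<theta> \<alpha>"
  shows "time_map f x < time_map f y"
proof (rule time_map_less)
  fix v assume v: "0 < v" "v < \<eta>"
  show "N x v < N y v"
  proof (rule DERIV_pos_imp_increasing[OF \<open>x < y\<close>])
    fix \<alpha> assume \<alpha>: "x \<le> \<alpha>" "\<alpha> \<le> y"
    then have *: "\<eta> \<le> \<alpha>" "ereal \<alpha> < \<beta>\<^sub>2" "0 < \<alpha>" using assms less_\<beta>\<^sub>2[of \<alpha> y] \<eta>_pos by auto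
    then show "\<exists>z. ((\<lambda>a. N a v) has_real_derivative z) (at \<alpha>) \<and> 0 < z"
      using N_deriv[OF *(1,2) v] dN_pos[OF *(1,2) v] \<theta>[OF \<alpha>] scaled_mem[OF v *(3)] by blast
  qed
qed (use assms less_\<beta>\<^sub>2[of x y] in \<open>auto simp: amplitudes_def\<close>)

lemma time_map_decreasing:
  assumes "\<eta> < x" "x < y" "ereal y < \<beta>\<^sub>2"
    and \<theta>: "\<And>\<alpha> w. x \<le> \<alpha> \<Longrightarrow> \<alpha> \<le> y \<Longrightarrow> 0 < w \<Longrightarrow> w < \<alpha> \<Longrightarrow> \<theta> \<alpha> < \<theta> w"
  shows "time_map f y < time_map f x"
proof (rule time_map_less)
  fix v assume v: "0 < v" "v < \<eta>"
  show "N y v < N x v"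
  proof (rule DERIV_neg_imp_decreasing[OF \<open>x < y\<close>])
    fix \<alpha> assume \<alpha>: "x \<le> \<alpha>" "\<alpha> \<le> y"
    then have *: "\<eta> \<le> \<alpha>" "ereal \<alpha> < \<beta>\<^sub>2" "0 < \<alpha>" using assms less_\<beta>\<^sub>2[of \<alpha> y] \<eta>_pos by auto
    then show "\<exists>z. ((\<lambda>a. N a v) has_real_derivative z) (at \<alpha>) \<and> z < 0"
      using N_deriv[OF *(1,2) v] dN_neg[OF *(1,2) v] \<theta>[OF \<alpha>] scaled_mem[OF v *(3)] by blast
  qed
qed (use assms less_\<beta>\<^sub>2[of x y] in \<open>auto simp: amplitudes_def\<close>)

lemma time_map_continuous_Icc:
  assumes "\<eta> < a" "a \<le> b" "ereal b < \<beta>\<^sub>2"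
  shows "continuous_on {a..b} (time_map f)"
  unfolding continuous_on_sequentially
proof (intro allI ballI impI, elim conjE)
  fix \<alpha> :: real and x :: "nat \<Rightarrow> real"
  assume \<alpha>: "\<alpha> \<in> {a..b}" and x: "\<forall>n. x n \<in> {a..b}" "x \<longlonglongrightarrow> \<alpha>"
  have I: "z \<in> I" if "z \<in> {a..b}" for z
    using that assms less_\<beta>\<^sub>2[of z b] by (auto simp: amplitudes_def)
  obtain k where k: "k > 0"
    "\<And>\<alpha> u. a \<le> \<alpha> \<Longrightarrow> \<alpha> \<le> b \<Longrightarrow> 0 \<le> u \<Longrightarrow> u \<le> \<alpha> \<Longrightarrow> k * (\<alpha> - u) \<le> F \<alpha> - F u"
    using energy_gap_lower_bound[OF assms] by metis
  \<comment> \<open>Because \<open>\<eta> \<le> x n\<close>, rescaling does not shrink the distance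
    to the right end: \<open>\<eta> - v \<le> x n - x n * v / \<eta>\<close>. The bound on the
    energy gap thus gives a majorant independent of \<open>n\<close>.\<close>
  define h where "h = (\<lambda>v. (b / sqrt k) * (1 / sqrt (\<eta> - v)))"
  have "(\<lambda>n. integral {0<..<\<eta>} (N (x n))) \<longlonglongrightarrow> integral {0<..<\<eta>} (N \<alpha>)"
  proof (rule dominated_convergence(2))
    show "N (x n) integrable_on {0<..<\<eta>}" for n
      using N_integrable[OF I] x(1) by (simp add: integrable_on_Icc_iff_Ioo)
    have "h integrable_on {0..\<eta>}"
      unfolding h_def using has_integral_inverse_sqrt[of \<eta>] \<eta>_pos
      by (intro integrable_on_mult_right) (auto simp: integrable_on_def)
    then show "h integrable_on {0<..<\<eta>}" by (simp add: integrable_on_Icc_iff_Ioo)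
  next
    fix n v assume "v \<in> {0<..<\<eta>}"
    then have v: "0 < v" "v < \<eta>" by auto
    define z where "z = x n"
    have z: "a \<le> z" "z \<le> b" using x(1) by (auto simp: z_def)
    then have z_pos: "\<eta> \<le> z" "0 < z" using assms \<eta>_pos by linarith+
    have "k * (\<eta> - v) \<le> k * (z - z * v / \<eta>)"
    proof -
      have "\<eta> * (1 - v / \<eta>) \<le> z * (1 - v / \<eta>)"
        by (rule mult_right_mono) (use z_pos v \<eta>_pos in auto)
      then have "\<eta> - v \<le> z - z * v / \<eta>" using \<eta>_pos by (simp add: right_diff_distrib)
      then show ?thesis using k(1) by (intro mult_left_mono) simp_all
    qed
    also have "\<dots> \<le> E z v"
      unfolding E_def by (rule k(2)) (use z scaled_mem[OF v z_pos(2)] in simp_all)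
    finally have "sqrt (k * (\<eta> - v)) \<le> sqrt (E z v)" by simp
    moreover have "0 < sqrt (k * (\<eta> - v))" using k(1) v by simp
    ultimately have "z / sqrt (E z v) \<le> b / sqrt (k * (\<eta> - v))"
      using z z_pos by (intro frac_le) simp_all
    moreover have "0 \<le> z / sqrt (E z v)"
      using z_pos \<open>sqrt (k * (\<eta> - v)) \<le> sqrt (E z v)\<close> \<open>0 < sqrt (k * (\<eta> - v))\<close>
      by (intro divide_nonneg_nonneg) linarith+
    ultimately show "norm (N (x n) v) \<le> h v"
      by (simp add: N_def h_def z_def real_sqrt_mult)
  next
    fix v assume "v \<in> {0<..<\<eta>}"
    then have "isCont (\<lambda>\<alpha>. N \<alpha> v) \<alpha>"
      using I[OF \<alpha>] by (intro DERIV_isCont[OF N_deriv]) (auto simp: amplitudes_def)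
    then show "(\<lambda>n. N (x n) v) \<longlonglongrightarrow> N \<alpha> v" by (rule isCont_tendsto_compose[OF _ x(2)])
  qed
  then have "(\<lambda>n. sqrt 2 * \<eta> * time_map f (x n)) \<longlonglongrightarrow> sqrt 2 * \<eta> * time_map f \<alpha>"
    using x(1) \<alpha> by (simp add: integral_open_interval_real[symmetric] N_integral[OF I])
  then show "(time_map f \<circ> x) \<longlonglongrightarrow> time_map f \<alpha>"
    using \<eta>_pos by (simp add: o_def tendsto_mult_left_iff)
qed

lemma open_amplitudes: "open I"
proof -
  have "I = {\<eta><..} \<inter> ereal -` {..<\<beta>\<^sub>2}" by (auto simp: amplitudes_def)
  moreover have "open (ereal -` {..<\<beta>\<^sub>2})"
    by (rule open_vimage) (auto intro: continuous_on_ereal continuous_on_id)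
  ultimately show ?thesis by (simp add: open_Int)
qed

lemma is_interval_amplitudes: "is_interval I"
  using less_\<beta>\<^sub>2 by (auto simp: is_interval_1 amplitudes_def)

lemma amplitudes_above:
  assumes "ereal x < \<beta>\<^sub>2"
  obtains y where "x < y" "ereal y < \<beta>\<^sub>2"
  using ereal_dense2[OF assms] by auto

lemma time_map_continuous: "continuous_on I (time_map f)"
proof (rule continuous_at_imp_continuous_on, rule ballI)
  fix x assume x: "x \<in> I"
  then obtain b where b: "x < b" "ereal b < \<beta>\<^sub>2" using amplitudes_above by (auto simp: amplitudes_def)
  have "continuous_on {(\<eta> + x)/2..b} (time_map f)"
    by (rule time_map_continuous_Icc) (use x b in \<open>auto simp: amplitudes_def\<close>)
  then show "isCont (time_map f) x"
    by (rule continuous_on_interior)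
      (use x b in \<open>simp add: amplitudes_def interior_atLeastAtMost_real\<close>)
qed

text \<open>\<open>F \<eta> = 0\<close> turns \<open>E \<eta> v\<close> into \<open>- F v\<close>
  and \<open>\<theta> \<eta>\<close> into \<open>- \<eta> * f \<eta>\<close>; the factor 2 undoes
  the one in the denominator of \<open>dN\<close>.\<close>

lemma G_integral_eq: "G_integral f \<eta> = improper_integral 0 \<eta> (\<lambda>v. 2 * dN \<eta> v)"
  unfolding G_integral_def
proof (rule improper_integral_cong)
  fix v assume v: "0 < v" "v < \<eta>"
  have "E \<eta> v = - F v" using \<eta>_pos F_\<eta> by (simp add: E_def)
  moreover have "0 < - F v" using F_neg[OF v] by simp
  then have "(- F v) powr (1 + 1/2) = - F v * sqrt (- F v)"
    unfolding powr_add by (simp add: powr_half_sqrt)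
  then have "(- F v) powr (3/2) = - F v * sqrt (- F v)" by simp
  moreover have "- \<eta> * f \<eta> - 2 * F v + v * f v = \<theta> \<eta> - \<theta> (\<eta> * v / \<eta>)"
    using \<eta>_pos F_\<eta> by (simp add: \<theta>_def)
  moreover have "x / y = 2 * (x / (2 * y))" for x y :: real by simp
  ultimately show "(- \<eta> * f \<eta> - 2 * F v + v * f v) / (- F v) powr (3 / 2) = 2 * dN \<eta> v"
    unfolding dN_def by metis
qed

end

section \<open>Convexity in a reparametrised amplitude\<close>

context time_map_problem
begin

text \<open>\<open>N\<close> is strictly convex as a function of \<open>\<tau>\<close>, where \<open>\<tau>' = 1 / P\<close>.\<close>

definition slope_increasing :: "real \<Rightarrow> real \<Rightarrow> (real \<Rightarrow> real) \<Rightarrow> (real \<Rightarrow> real) \<Rightarrow> bool" where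
  "slope_increasing a b P \<tau> \<longleftrightarrow>
     (\<forall>x\<in>{a..b}. 0 < P x \<and> isCont P x \<and> (\<tau> has_real_derivative 1 / P x) (at x)) \<and>
     (\<forall>x\<in>{a..b}. \<forall>v\<in>{0<..<\<eta>}. \<exists>d>0. ((\<lambda>x. P x * dN x v) has_real_derivative d) (at x))"

lemma slope_increasing_less:
  assumes "slope_increasing a b P \<tau>" "a \<le> x" "x < y" "y \<le> b" "0 < v" "v < \<eta>"
  shows "P x * dN x v < P y * dN y v"
  by (rule DERIV_pos_imp_increasing[OF \<open>x < y\<close>])
    (use assms in \<open>force simp: slope_increasing_def\<close>)

lemma slope_increasing_reparam:
  assumes "slope_increasing a b P \<tau>" "a \<le> x" "x < y" "y \<le> b"
  shows "\<tau> x < \<tau> y"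
proof (rule DERIV_pos_imp_increasing[OF \<open>x < y\<close>])
  fix z assume "x \<le> z" "z \<le> y"
  then have "0 < P z" "(\<tau> has_real_derivative 1 / P z) (at z)"
    using assms by (auto simp: slope_increasing_def)
  then show "\<exists>d. (\<tau> has_real_derivative d) (at z) \<and> 0 < d" by (intro exI[of _ "1 / P z"]) simp
qed

text \<open>By Cauchy's mean value theorem the chord slope of \<open>N\<close> against \<tau> equals
  \<open>P c * dN c v\<close> at an intermediate \<open>c\<close>, and this quantity is strictly
  increasing in the amplitude.\<close>

lemma slope_bounds:
  assumes si: "slope_increasing a b P \<tau>" and "\<eta> \<le> a" "ereal b < \<beta>\<^sub>2"
    and xy: "a \<le> x" "x < y" "y \<le> b" and v: "0 < v" "v < \<eta>"
  shows "P x * dN x v * (\<tau> y - \<tau> x) < N y v - N x v"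
    and "N y v - N x v < P y * dN y v * (\<tau> y - \<tau> x)"
proof -
  have dN: "((\<lambda>\<alpha>. N \<alpha> v) has_real_derivative dN z v) (at z)" if "x \<le> z" "z \<le> y" for z
    using N_deriv[of z v] that assms less_\<beta>\<^sub>2[of z b] by simp
  have d\<tau>: "(\<tau> has_real_derivative 1 / P z) (at z)" "0 < P z" if "x \<le> z" "z \<le> y" for z
    using si that xy by (auto simp: slope_increasing_def)
  have "\<exists>c. x < c \<and> c < y \<and> (N y v - N x v) * (1 / P c) = (\<tau> y - \<tau> x) * dN c v"
    by (rule GMVT'[OF \<open>x < y\<close>]) (auto intro: dN d\<tau> DERIV_isCont)
  then obtain c where c: "x < c" "c < y" "(N y v - N x v) * (1 / P c) = (\<tau> y - \<tau> x) * dN c v"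
    by blast
  have "N y v - N x v = P c * dN c v * (\<tau> y - \<tau> x)"
    using c(3) d\<tau>(2)[of c] c(1,2) by (simp add: field_simps)
  moreover have "P x * dN x v < P c * dN c v" "P c * dN c v < P y * dN y v"
    using slope_increasing_less[OF si _ c(1) _ v] slope_increasing_less[OF si _ c(2) _ v] xy c by auto
  moreover have "0 < \<tau> y - \<tau> x" using slope_increasing_reparam[OF si xy] by simp
  ultimately show "P x * dN x v * (\<tau> y - \<tau> x) < N y v - N x v"
    "N y v - N x v < P y * dN y v * (\<tau> y - \<tau> x)"
    by (simp_all add: mult_strict_right_mono)
qed

lemma N_diff_integral:
  assumes "x \<in> I" "y \<in> I"
  shows "integral {0..\<eta>} (\<lambda>v. c * (N y v - N x v))
    = c * (sqrt 2 * \<eta> * (time_map f y - time_map f x))"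
proof -
  have "((\<lambda>v. c * (N y v - N x v)) has_integral
      c * (sqrt 2 * \<eta> * time_map f y - sqrt 2 * \<eta> * time_map f x)) {0..\<eta>}"
    by (intro has_integral_mult_right has_integral_diff N_has_integral assms)
  then show ?thesis by (simp add: right_diff_distrib integral_unique)
qed

text \<open>The slope at \<open>y\<close> separates the chords on either side of it. The chord
  lengths \<open>p\<close> and \<open>q\<close> in \<tau> do not involve v, so the cross-multiplied
  inequality integrates to the same one for the time map.\<close>

lemma time_map_turn:
  assumes si: "slope_increasing a b P \<tau>" and "\<eta> \<le> a" "ereal b < \<beta>\<^sub>2"
    and "\<eta> < x" "a \<le> x" "x < y" "y < z" "z \<le> b" and T: "time_map f z \<le> time_map f y"
  shows "time_map f y < time_map f x"
proof -
  have I: "x \<in> I" "y \<in> I" "z \<in> I"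
    using assms less_\<beta>\<^sub>2[of _ b] by (auto simp: amplitudes_def)
  then have cont: "continuous_on {0<..<\<eta>} (N x)" "continuous_on {0<..<\<eta>} (N y)" "continuous_on {0<..<\<eta>} (N z)"
    by (auto intro!: N_cont simp: amplitudes_def)
  define p q where "p = \<tau> y - \<tau> x" and "q = \<tau> z - \<tau> y"
  have pq: "0 < p" "0 < q"
    using slope_increasing_reparam[OF si, of x y] slope_increasing_reparam[OF si, of y z] assms
    by (auto simp: p_def q_def)
  have "integral {0..\<eta>} (\<lambda>v. q * (N y v - N x v)) < integral {0..\<eta>} (\<lambda>v. p * (N z v - N y v))"
  proof (rule integral_strict_mono_real)
    fix v assume v: "0 < v" "v < \<eta>"
    have "q * (N y v - N x v) < q * (P y * dN y v * p)"
      using slope_bounds(2)[OF si assms(2,3), of x y v] assms v pq(2) unfolding p_def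
      by (intro mult_strict_left_mono) auto
    also have "\<dots> = p * (P y * dN y v * q)" by simp
    also have "\<dots> < p * (N z v - N y v)"
      using slope_bounds(1)[OF si assms(2,3), of y z v] assms v pq(1) unfolding q_def
      by (intro mult_strict_left_mono) auto
    finally show "q * (N y v - N x v) < p * (N z v - N y v)" .
  qed (use \<eta>_pos I N_integrable cont in
      \<open>auto intro!: integrable_on_mult_right integrable_diff continuous_intros\<close>)
  then have "q * (sqrt 2 * \<eta> * (time_map f y - time_map f x)) < p * (sqrt 2 * \<eta> * (time_map f z - time_map f y))"
    unfolding N_diff_integral[OF I(1,2)] N_diff_integral[OF I(2,3)] .
  also have "\<dots> \<le> 0" using pq \<eta>_pos T by (simp add: mult_le_0_iff)
  finally show ?thesis using pq \<eta>_pos by (simp add: mult_less_0_iff)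
qed

text \<open>The slope at \<eta> lies below every chord slope to its right. So the integrand of G is
  strictly below a positive multiple of \<open>N y v - N x v\<close>, whose integral has the sign of
  the increment of the time map.\<close>

lemma time_map_less_if_G_nonneg:
  assumes si: "slope_increasing \<eta> b P \<tau>" and b: "ereal b < \<beta>\<^sub>2"
    and xy: "\<eta> < x" "x < y" "y \<le> b" and G: "0 \<le> G_integral f \<eta>"
  shows "time_map f x < time_map f y"
proof -
  have I: "x \<in> I" "y \<in> I"
    using assms less_\<beta>\<^sub>2[of _ b] by (auto simp: amplitudes_def)
  have P: "0 < P \<eta>" and p: "0 < \<tau> y - \<tau> x"
    using si xy slope_increasing_reparam[OF si, of x y] by (auto simp: slope_increasing_def)
  \<comment> \<open>Normalised so that the slope at \<eta> becomes \<open>2 * dN \<eta> v\<close>,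
    the integrand of G.\<close>
  define c where "c = 2 / (P \<eta> * (\<tau> y - \<tau> x))"
  have c: "0 < c" using P p by (simp add: c_def)
  have "G_integral f \<eta> < ereal (integral {0..\<eta>} (\<lambda>v. c * (N y v - N x v)))"
    unfolding G_integral_eq
  proof (rule improper_integral_less[OF \<eta>_pos])
    fix v assume v: "0 < v" "v < \<eta>"
    have "P \<eta> * dN \<eta> v * (\<tau> y - \<tau> x) < P x * dN x v * (\<tau> y - \<tau> x)"
      using slope_increasing_less[OF si _ xy(1) _ v] xy p by (intro mult_strict_right_mono) auto
    also have "\<dots> < N y v - N x v"
      by (rule slope_bounds[OF si _ b]) (use xy v in auto)
    finally show "2 * dN \<eta> v < c * (N y v - N x v)"
      using P p by (simp add: c_def field_simps)
  qed (use \<eta>_pos I N_integrable N_cont \<eta>_less in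
      \<open>auto intro!: integrable_on_mult_right integrable_diff continuous_intros simp: amplitudes_def\<close>)
  then have "0 < integral {0..\<eta>} (\<lambda>v. c * (N y v - N x v))"
    using G by (metis ereal_less(2) order_le_less_trans)
  then have "0 < c * (sqrt 2 * \<eta> * (time_map f y - time_map f x))"
    unfolding N_diff_integral[OF I] .
  moreover have "0 < c * (sqrt 2 * \<eta>)" using c \<eta>_pos by simp
  ultimately show ?thesis
    using zero_less_mult_pos[of "c * (sqrt 2 * \<eta>)" "time_map f y - time_map f x"]
    by (simp only: mult.assoc diff_gt_0_iff_gt)
qed

text \<open>Chord slopes over amplitudes shrinking to \<eta> decrease to the slope at \<eta>, and
  their integrals are nonnegative because the time map increases.\<close>

lemma G_nonneg_if_time_map_increasing:
  assumes si: "slope_increasing \<eta> b P \<tau>" and b: "\<eta> < b" "ereal b < \<beta>\<^sub>2"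
    and T: "strict_mono_on I (time_map f)"
  shows "0 \<le> G_integral f \<eta>"
proof -
  \<comment> \<open>Chords join consecutive points of this sequence instead of starting at \<eta>,
    which is not an amplitude and where \<open>N\<close> need not be integrable. Adjacent chords
    share an endpoint, so the slope there orders them.\<close>
  define \<alpha> where "\<alpha> = (\<lambda>n::nat. \<eta> + (b - \<eta>) / (real n + 1))"
  have \<alpha>: "\<eta> < \<alpha> n" "\<alpha> n \<le> b" "\<alpha> (Suc n) < \<alpha> n" for n
    using b mult_right_mono[of \<eta> b "real n"] by (auto simp: \<alpha>_def field_simps)
  have "(\<lambda>n. (b - \<eta>) / (real n + 1)) \<longlonglongrightarrow> 0"
    using LIMSEQ_Suc[OF lim_const_over_n[of "b - \<eta>"]] by (simp add: add.commute)
  from tendsto_add[OF tendsto_const[of \<eta>] this] have lim: "\<alpha> \<longlonglongrightarrow> \<eta>" by (simp add: \<alpha>_def)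
  have I: "\<alpha> n \<in> I" for n using \<alpha>[of n] b less_\<beta>\<^sub>2[of "\<alpha> n" b] by (auto simp: amplitudes_def)
  define p where "p = (\<lambda>n. \<tau> (\<alpha> n) - \<tau> (\<alpha> (Suc n)))"
  have p: "0 < p n" for n
    using slope_increasing_reparam[OF si _ \<alpha>(3)[of n]] \<alpha>(1)[of "Suc n"] \<alpha>(2)[of n] by (auto simp: p_def)
  define S where "S = {0<..<\<eta>}"
  define Q where "Q = (\<lambda>n v. (1 / p n) * (N (\<alpha> n) v - N (\<alpha> (Suc n)) v))"
  define D where "D = (\<lambda>\<alpha> v. P \<alpha> * dN \<alpha> v)"
  have Q: "D (\<alpha> (Suc n)) v < Q n v" "Q n v < D (\<alpha> n) v" if v: "v \<in> S" for n v
  proof -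
    have "D (\<alpha> (Suc n)) v * p n < N (\<alpha> n) v - N (\<alpha> (Suc n)) v"
      "N (\<alpha> n) v - N (\<alpha> (Suc n)) v < D (\<alpha> n) v * p n"
      unfolding D_def p_def using v \<alpha>(1)[of "Suc n"] \<alpha>(2)[of n]
      by (auto simp: S_def intro!: slope_bounds[OF si _ b(2) _ \<alpha>(3)[of n]])
    then show "D (\<alpha> (Suc n)) v < Q n v" "Q n v < D (\<alpha> n) v"
      unfolding Q_def using p[of n] by (simp_all add: pos_less_divide_eq pos_divide_less_eq)
  qed
  have N_int: "N (\<alpha> n) integrable_on S" for n
    using N_integrable[OF I] by (simp add: S_def integrable_on_Icc_iff_Ioo)
  have Q_int: "Q n integrable_on S" for n
    unfolding Q_def by (intro integrable_on_mult_right integrable_diff N_int)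
  have Q_dec: "Q (Suc n) v \<le> Q n v" if "v \<in> S" for n v
    using Q(2)[OF that, of "Suc n"] Q(1)[OF that, of n] by simp
  have Q_lim: "(\<lambda>n. Q n v) \<longlonglongrightarrow> D \<eta> v" if v: "v \<in> S" for v
  proof -
    have "\<exists>d>0. ((\<lambda>x. P x * dN x v) has_real_derivative d) (at \<eta>)"
      using si v b by (simp add: slope_increasing_def S_def)
    then have "isCont (\<lambda>x. D x v) \<eta>" unfolding D_def using DERIV_isCont by blast
    from isCont_tendsto_compose[OF this lim] have up: "(\<lambda>n. D (\<alpha> n) v) \<longlonglongrightarrow> D \<eta> v" .
    show ?thesis
      by (rule tendsto_sandwich[OF _ _ LIMSEQ_Suc[OF up] up])
        (auto intro!: always_eventually less_imp_le Q v)
  qed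
  have Q_nonneg: "0 \<le> integral S (Q n)" for n
  proof -
    have "integral S (Q n) = (1 / p n) * (sqrt 2 * \<eta> * (time_map f (\<alpha> n) - time_map f (\<alpha> (Suc n))))"
      unfolding Q_def S_def integral_open_interval_real[symmetric] by (rule N_diff_integral[OF I I])
    also have "\<dots> \<ge> 0"
      using p[of n] \<eta>_pos strict_mono_onD[OF T I I \<alpha>(3)[of n]] by (simp add: less_imp_le)
    finally show ?thesis .
  qed
  have Q_le: "integral S (Q n) \<le> integral S (Q 0)" for n
  proof (induction n)
    case (Suc n)
    have "integral S (Q (Suc n)) \<le> integral S (Q n)" by (intro integral_le Q_int Q_dec)
    then show ?case using Suc by simp
  qed simp
  have "bounded (range (\<lambda>k. integral S (Q k)))"
    by (rule bounded_subset[of "{0..integral S (Q 0)}"]) (use Q_nonneg Q_le in auto)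
  \<comment> \<open>The lower bound 0 on the integrals makes the limit integrable as well, which
    excludes G = -\<infinity>.\<close>
  from monotone_convergence_decreasing[of Q S, OF Q_int Q_dec Q_lim this]
  have D: "D \<eta> integrable_on S" "(\<lambda>k. integral S (Q k)) \<longlonglongrightarrow> integral S (D \<eta>)" by auto
  have D_nonneg: "0 \<le> integral S (D \<eta>)" by (rule LIMSEQ_le_const[OF D(2)]) (use Q_nonneg in auto)
  have P: "0 < P \<eta>" using si b by (simp add: slope_increasing_def)
  have dN_eq: "(\<lambda>v. 2 * dN \<eta> v) = (\<lambda>v. (2 / P \<eta>) * D \<eta> v)" using P by (simp add: D_def)
  have D': "D \<eta> integrable_on {0..\<eta>}" "0 \<le> integral {0..\<eta>} (D \<eta>)"
    using D(1) D_nonneg by (simp_all add: S_def integrable_on_Icc_iff_Ioo integral_open_interval_real)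
  have "G_integral f \<eta> = ereal (integral {0..\<eta>} (\<lambda>v. (2 / P \<eta>) * D \<eta> v))"
    unfolding G_integral_eq dN_eq
    by (intro improper_integral_eq_integral[OF \<eta>_pos] integrable_on_mult_right D')
  then show ?thesis using D' P by simp
qed

end

section \<open>Monotonicity of the quotient\<close>

context time_map_problem
begin

lemma quotient_deriv: "0 < u \<Longrightarrow> ((\<lambda>t. f t / t) has_real_derivative - d\<theta> u / u\<^sup>2) (at u)"
  by (auto intro!: derivative_eq_intros f_deriv simp: d\<theta>_def field_simps power2_eq_square)

lemma deriv_quotient: "0 < u \<Longrightarrow> deriv (\<lambda>t. f t / t) u = - d\<theta> u / u\<^sup>2"
  by (rule DERIV_imp_deriv[OF quotient_deriv])

lemma deriv_quotient_sign:
  assumes "0 < u"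
  shows "0 < deriv (\<lambda>t. f t / t) u \<longleftrightarrow> d\<theta> u < 0" "deriv (\<lambda>t. f t / t) u < 0 \<longleftrightarrow> 0 < d\<theta> u"
  using assms by (simp_all only: deriv_quotient zero_less_divide_iff divide_less_0_iff) simp_all

lemma \<theta>_strict_decreasing:
  assumes "0 < x" "x < y" "\<And>u. x < u \<Longrightarrow> u < y \<Longrightarrow> d\<theta> u < 0"
  shows "\<theta> y < \<theta> x"
proof (rule DERIV_neg_imp_decreasing_open[OF assms(2)])
  show "continuous_on {x..y} \<theta>"
    by (intro continuous_at_imp_continuous_on ballI \<theta>_isCont) (use assms(1) in auto)
next
  fix u assume "x < u" "u < y"
  then show "\<exists>d. (\<theta> has_real_derivative d) (at u) \<and> d < 0"
    using \<theta>_deriv[of u] assms by (intro exI[of _ "d\<theta> u"]) auto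
qed

lemma \<theta>_strict_increasing:
  assumes "0 < x" "x < y" "\<And>u. x < u \<Longrightarrow> u < y \<Longrightarrow> 0 < d\<theta> u"
  shows "\<theta> x < \<theta> y"
proof (rule DERIV_pos_imp_increasing_open[OF assms(2)])
  show "continuous_on {x..y} \<theta>"
    by (intro continuous_at_imp_continuous_on ballI \<theta>_isCont) (use assms(1) in auto)
next
  fix u assume "x < u" "u < y"
  then show "\<exists>d. (\<theta> has_real_derivative d) (at u) \<and> 0 < d"
    using \<theta>_deriv[of u] assms by (intro exI[of _ "d\<theta> u"]) auto
qed

lemma time_map_decreasing_if_quotient_increasing:
  assumes "quotient_increasing f \<beta>\<^sub>2"
  shows "strict_antimono_on I (time_map f)"
proof (rule monotone_onI)
  fix x y assume xy: "x \<in> I" "y \<in> I" "x < y"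
  have "time_map f y < time_map f x"
  proof (rule time_map_decreasing)
    fix \<alpha> w assume \<alpha>: "x \<le> \<alpha>" "\<alpha> \<le> y" "0 < w" "w < \<alpha>"
    show "\<theta> \<alpha> < \<theta> w"
    proof (rule \<theta>_strict_decreasing)
      fix u assume u: "w < u" "u < \<alpha>"
      then have "ereal u < \<beta>\<^sub>2" using less_\<beta>\<^sub>2[of u y] \<alpha> xy by (auto simp: amplitudes_def)
      then show "d\<theta> u < 0"
        using assms deriv_quotient_sign(1)[of u] u \<alpha> by (simp add: quotient_increasing_def)
    qed (use \<alpha> in auto)
  qed (use xy in \<open>auto simp: amplitudes_def\<close>)
  then show "time_map f x > time_map f y" .
qed

lemma f_\<beta>\<^sub>1: "f \<beta>\<^sub>1 \<le> 0"
proof (rule tendsto_upperbound)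
  show "(f \<longlongrightarrow> f \<beta>\<^sub>1) (at_left \<beta>\<^sub>1)"
    using f_cont[OF \<beta>\<^sub>1_pos] by (simp add: isCont_def filterlim_at_split)
  show "\<forall>\<^sub>F u in at_left \<beta>\<^sub>1. f u \<le> 0"
    by (rule eventually_at_leftI[OF _ \<beta>\<^sub>1_pos]) (use f_neg in \<open>auto intro: less_imp_le\<close>)
qed simp

lemma f_\<beta>\<^sub>2:
  assumes "\<beta>\<^sub>2 = ereal B"
  shows "0 < B" "f B = 0"
proof -
  show "0 < B" using \<beta>\<^sub>1_pos \<beta>\<^sub>1_less assms by simp
  have "(f \<longlongrightarrow> f B) (at_right B)" "(f \<longlongrightarrow> f B) (at_left B)"
    using f_cont[OF \<open>0 < B\<close>] by (auto simp: isCont_def filterlim_at_split)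
  moreover have "\<forall>\<^sub>F u in at_right B. f u \<le> 0"
    by (rule eventually_at_rightI[of B "B + 1"]) (use f_neg' assms in \<open>auto intro: less_imp_le\<close>)
  moreover have "\<forall>\<^sub>F u in at_left B. 0 \<le> f u"
    by (rule eventually_at_leftI[of \<beta>\<^sub>1]) (use f_pos \<beta>\<^sub>1_less assms in \<open>auto intro: less_imp_le\<close>)
  ultimately have "f B \<le> 0" "0 \<le> f B"
    using tendsto_upperbound[of f "f B" "at_right B"] tendsto_lowerbound[of f "f B" "at_left B"]
    by auto
  then show "f B = 0" by simp
qed

end

section \<open>Location of \<sigma> and the behaviour of \<theta> when the quotient is
  unimodal\<close>

locale unimodal_time_map_problem = time_map_problem +
  fixes \<sigma> :: real
  assumes unimodal: "quotient_unimodal f \<beta>\<^sub>2 \<sigma>"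
begin

lemma \<sigma>_pos: "0 < \<sigma>"
  using unimodal by (simp add: quotient_unimodal_def)

lemma d\<theta>_neg: "0 < u \<Longrightarrow> u < \<sigma> \<Longrightarrow> d\<theta> u < 0"
  using unimodal deriv_quotient_sign(1)[of u] by (simp add: quotient_unimodal_def)

lemma d\<theta>_\<sigma>: "d\<theta> \<sigma> = 0"
  using unimodal deriv_quotient[of \<sigma>] \<sigma>_pos by (simp add: quotient_unimodal_def)

lemma d\<theta>_pos: "\<sigma> < u \<Longrightarrow> ereal u < \<beta>\<^sub>2 \<Longrightarrow> 0 < d\<theta> u"
  using unimodal deriv_quotient_sign(2)[of u] \<sigma>_pos by (simp add: quotient_unimodal_def)

text \<open>Otherwise \<open>f u / u\<close> would decrease between \<open>\<beta>\<^sub>1\<close>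
  and \<open>\<eta>\<close>, from a value at most 0 to a positive one.\<close>

lemma \<beta>\<^sub>1_less_\<sigma>: "\<beta>\<^sub>1 < \<sigma>"
proof (rule ccontr)
  assume "\<not> \<beta>\<^sub>1 < \<sigma>"
  have "f \<eta> / \<eta> < f \<beta>\<^sub>1 / \<beta>\<^sub>1"
  proof (rule DERIV_neg_imp_decreasing_open[OF \<beta>\<^sub>1_\<eta>])
    fix u assume u: "\<beta>\<^sub>1 < u" "u < \<eta>"
    then have "0 < d\<theta> u" using d\<theta>_pos[of u] \<open>\<not> \<beta>\<^sub>1 < \<sigma>\<close> less_\<beta>\<^sub>2[of u \<eta>] \<eta>_less by simp
    then show "\<exists>y. ((\<lambda>t. f t / t) has_real_derivative y) (at u) \<and> y < 0"
      using quotient_deriv[of u] u \<beta>\<^sub>1_pos by (intro exI[of _ "- d\<theta> u / u\<^sup>2"]) (auto simp: divide_neg_pos)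
  next
    show "continuous_on {\<beta>\<^sub>1..\<eta>} (\<lambda>t. f t / t)"
      by (intro continuous_at_imp_continuous_on ballI DERIV_isCont[OF quotient_deriv])
        (use \<beta>\<^sub>1_pos in auto)
  qed
  moreover have "0 < f \<eta> / \<eta>" using f_pos[OF \<beta>\<^sub>1_\<eta> \<eta>_less] \<eta>_pos by simp
  moreover have "f \<beta>\<^sub>1 / \<beta>\<^sub>1 \<le> 0" using f_\<beta>\<^sub>1 \<beta>\<^sub>1_pos by (simp add: divide_le_0_iff)
  ultimately show False by simp
qed

text \<open>Otherwise \<open>\<beta>\<^sub>2\<close> is finite and \<open>f u / u\<close> would
  increase from its positive value at \<open>\<eta>\<close> to the value 0 at
  \<open>\<beta>\<^sub>2\<close>.\<close>

lemma \<sigma>_less_\<beta>\<^sub>2: "ereal \<sigma> < \<beta>\<^sub>2"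
proof (rule ccontr)
  assume *: "\<not> ereal \<sigma> < \<beta>\<^sub>2"
  then obtain B where B: "\<beta>\<^sub>2 = ereal B" using \<beta>\<^sub>1_less by (cases \<beta>\<^sub>2) auto
  then have "\<eta> < B" "B \<le> \<sigma>" using \<eta>_less * by auto
  have "f \<eta> / \<eta> < f B / B"
  proof (rule DERIV_pos_imp_increasing_open[OF \<open>\<eta> < B\<close>])
    fix u assume u: "\<eta> < u" "u < B"
    then have "d\<theta> u < 0" using d\<theta>_neg[of u] \<open>B \<le> \<sigma>\<close> \<eta>_pos by simp
    then show "\<exists>y. ((\<lambda>t. f t / t) has_real_derivative y) (at u) \<and> 0 < y"
      using quotient_deriv[of u] u \<eta>_pos by (intro exI[of _ "- d\<theta> u / u\<^sup>2"]) (auto simp: divide_neg_pos)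
  next
    show "continuous_on {\<eta>..B} (\<lambda>t. f t / t)"
      by (intro continuous_at_imp_continuous_on ballI DERIV_isCont[OF quotient_deriv])
        (use \<eta>_pos in auto)
  qed
  moreover have "0 < f \<eta> / \<eta>" using f_pos[OF \<beta>\<^sub>1_\<eta> \<eta>_less] \<eta>_pos by simp
  ultimately show False using f_\<beta>\<^sub>2[OF B] by simp
qed

lemma \<theta>_decreasing: "0 < x \<Longrightarrow> x < y \<Longrightarrow> y \<le> \<sigma> \<Longrightarrow> \<theta> y < \<theta> x"
  by (rule \<theta>_strict_decreasing) (auto intro: d\<theta>_neg)

lemma \<theta>_increasing: "\<sigma> \<le> x \<Longrightarrow> x < y \<Longrightarrow> ereal y < \<beta>\<^sub>2 \<Longrightarrow> \<theta> x < \<theta> y"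
  by (rule \<theta>_strict_increasing) (use \<sigma>_pos less_\<beta>\<^sub>2[OF less_imp_le] in \<open>auto intro!: d\<theta>_pos\<close>)

text \<open>Since \<open>(F / u\<^sup>2)' = - \<theta> / u\<^sup>3\<close>, a bound \<open>\<theta> \<ge> \<epsilon> > 0\<close> near 0 would make \<open>(F - \<epsilon>/2) / u\<^sup>2\<close>
  nonincreasing there, but this function tends to \<open>-\<infinity>\<close> at 0.\<close>

lemma \<theta>_neg:
  assumes "0 < u" "u \<le> \<sigma>"
  shows "\<theta> u < 0"
proof (rule ccontr)
  assume "\<not> \<theta> u < 0"
  \<comment> \<open>Moving left of \<open>u\<close> turns the weak sign
    \<open>0 \<le> \<theta> u\<close> into the strict \<open>0 < \<theta> \<delta>\<close>, as
    \<theta> decreases strictly.\<close>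
  define \<delta> where "\<delta> = u / 2"
  define \<epsilon> where "\<epsilon> = \<theta> \<delta>"
  have \<delta>: "0 < \<delta>" "\<delta> < \<sigma>" "\<delta> < u" using assms by (auto simp: \<delta>_def)
  have "0 < \<epsilon>" using \<theta>_decreasing[of \<delta> u] \<delta> assms \<open>\<not> \<theta> u < 0\<close> by (simp add: \<epsilon>_def)
  define H where "H = (\<lambda>u. (F u - \<epsilon> / 2) / u\<^sup>2)"
  have H: "H \<delta> \<le> H x" if "0 < x" "x < \<delta>" for x
  proof (rule DERIV_nonpos_imp_nonincreasing[of x \<delta> H])
    fix z assume z: "x \<le> z" "z \<le> \<delta>"
    have "(H has_real_derivative (f z * z\<^sup>2 - (F z - \<epsilon> / 2) * (2 * z)) / (z\<^sup>2 * z\<^sup>2)) (at z)"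
      unfolding H_def using z that by (auto intro!: derivative_eq_intros F_deriv)
    moreover have "f z * z\<^sup>2 - (F z - \<epsilon> / 2) * (2 * z) = z * (\<epsilon> - \<theta> z)"
      by (simp add: \<theta>_def algebra_simps power2_eq_square)
    moreover have "\<epsilon> \<le> \<theta> z" using \<theta>_decreasing[of z \<delta>] z that \<delta> by (cases "z = \<delta>") (auto simp: \<epsilon>_def)
    then have "z * (\<epsilon> - \<theta> z) / (z\<^sup>2 * z\<^sup>2) \<le> 0"
      using z that by (intro divide_nonpos_nonneg mult_nonneg_nonpos) auto
    ultimately show "\<exists>y. (H has_real_derivative y) (at z) \<and> y \<le> 0" by auto
  qed (use that in simp)
  have "(F \<longlongrightarrow> F 0) (at_right 0)"
    using F_cont[of 1] by (rule continuous_on_Icc_at_rightD) simp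
  then have "\<forall>\<^sub>F x in at_right 0. F x < \<epsilon> / 4"
    using \<open>0 < \<epsilon>\<close> by (intro order_tendstoD) (auto simp: F_0)
  moreover have "((\<lambda>x. H \<delta> * x\<^sup>2) \<longlongrightarrow> H \<delta> * 0\<^sup>2) (at_right 0)" by (intro tendsto_intros)
  then have "\<forall>\<^sub>F x in at_right 0. - \<epsilon> / 4 < H \<delta> * x\<^sup>2"
    using \<open>0 < \<epsilon>\<close> by (intro order_tendstoD) auto
  moreover have "\<forall>\<^sub>F x in at_right 0. 0 < x \<and> x < \<delta>"
    by (rule eventually_at_rightI[OF _ \<delta>(1)]) auto
  ultimately have "\<forall>\<^sub>F x in at_right (0::real). False"
  proof eventually_elim
    fix x assume x: "F x < \<epsilon> / 4" "- \<epsilon> / 4 < H \<delta> * x\<^sup>2" "0 < x \<and> x < \<delta>"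
    have "H \<delta> * x\<^sup>2 \<le> H x * x\<^sup>2" using H[of x] x(3) by (intro mult_right_mono) auto
    also have "\<dots> = F x - \<epsilon> / 2" using x(3) by (simp add: H_def)
    finally show False using x by simp
  qed
  then show False by (simp add: eventually_False trivial_limit_at_right_real)
qed

lemma time_map_decreasing_up_to_\<sigma>:
  "\<eta> < x \<Longrightarrow> x < y \<Longrightarrow> y \<le> \<sigma> \<Longrightarrow> time_map f y < time_map f x"
  using \<sigma>_less_\<beta>\<^sub>2 less_\<beta>\<^sub>2[of y \<sigma>] by (intro time_map_decreasing) (auto intro: \<theta>_decreasing)

text \<open>From \<open>\<alpha>\<^sub>1\<close> on, \<theta> exceeds all its earlier values: it is
  negative up to \<sigma>, increasing afterwards, and already nonnegative at
  \<open>\<alpha>\<^sub>1\<close>. So here the integrand increases pointwise.\<close>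

lemma time_map_increasing_from:
  assumes "\<sigma> \<le> \<alpha>\<^sub>1" "0 \<le> \<theta> \<alpha>\<^sub>1"
  shows "strict_mono_on {\<alpha>\<in>I. \<alpha>\<^sub>1 \<le> \<alpha>} (time_map f)"
proof (rule strict_mono_onI)
  fix x y assume xy: "x \<in> {\<alpha>\<in>I. \<alpha>\<^sub>1 \<le> \<alpha>}" "y \<in> {\<alpha>\<in>I. \<alpha>\<^sub>1 \<le> \<alpha>}" "x < y"
  show "time_map f x < time_map f y"
  proof (rule time_map_increasing)
    fix \<alpha> w assume \<alpha>: "x \<le> \<alpha>" "\<alpha> \<le> y" "0 < w" "w < \<alpha>"
    then have \<alpha>': "\<alpha>\<^sub>1 \<le> \<alpha>" "ereal \<alpha> < \<beta>\<^sub>2" using xy less_\<beta>\<^sub>2[of \<alpha> y] by (auto simp: amplitudes_def)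
    show "\<theta> w < \<theta> \<alpha>"
    proof (cases "w \<le> \<sigma>")
      case True
      have "0 \<le> \<theta> \<alpha>" using \<theta>_increasing[of \<alpha>\<^sub>1 \<alpha>] \<alpha>' assms by (cases "\<alpha>\<^sub>1 = \<alpha>") auto
      then show ?thesis using \<theta>_neg[of w] True \<alpha> by simp
    next
      case False
      then show ?thesis using \<theta>_increasing[of w \<alpha>] \<alpha> \<alpha>' by simp
    qed
  qed (use xy in \<open>auto simp: amplitudes_def\<close>)
qed

end

section \<open>The convexity criterion and the shape of the curve\<close>

text \<open>Where the second derivative is positive, the first one is larger just to the right and
  smaller just to the left; the mean value theorem then makes a symmetric second difference
  positive, against the midpoint inequality.\<close>

lemma midpoint_concave_imp_deriv_antimono:
  fixes \<phi> \<phi>' \<phi>'' :: "real \<Rightarrow> real"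
  assumes "open S" "is_interval S"
    and d1: "\<And>x. x \<in> S \<Longrightarrow> (\<phi> has_real_derivative \<phi>' x) (at x)"
    and d2: "\<And>x. x \<in> S \<Longrightarrow> (\<phi>' has_real_derivative \<phi>'' x) (at x)"
    and mid: "\<And>x y. x \<in> S \<Longrightarrow> y \<in> S \<Longrightarrow> (\<phi> x + \<phi> y) / 2 \<le> \<phi> ((x + y) / 2)"
    and xy: "x \<in> S" "y \<in> S" "x \<le> y"
  shows "\<phi>' y \<le> \<phi>' x"
proof -
  have nonpos: "\<phi>'' z \<le> 0" if z: "z \<in> S" for z
  proof (rule ccontr)
    assume "\<not> \<phi>'' z \<le> 0"
    then have "0 < \<phi>'' z" by simp
    then obtain r where r: "0 < r" "\<And>h. 0 < h \<Longrightarrow> h < r \<Longrightarrow> \<phi>' z < \<phi>' (z + h)"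
      using DERIV_pos_inc_right[OF d2[OF z]] by blast
    obtain l where l: "0 < l" "\<And>h. 0 < h \<Longrightarrow> h < l \<Longrightarrow> \<phi>' (z - h) < \<phi>' z"
      using DERIV_pos_inc_left[OF d2[OF z]] \<open>0 < \<phi>'' z\<close> by blast
    obtain e where e: "0 < e" "ball z e \<subseteq> S" using \<open>open S\<close> z open_contains_ball by blast
    define h where "h = min r (min l e) / 2"
    have h: "0 < h" "h < r" "h < l" "h < e" using r(1) l(1) e(1) by (auto simp: h_def)
    have S: "t \<in> S" if "z - h \<le> t" "t \<le> z + h" for t
    proof -
      have "dist z t < e" using that h(4) by (simp add: dist_real_def)
      then show ?thesis using e(2) by auto
    qed
    have "z < z + h" "z - h < z" using h by auto
    obtain u where u: "z < u" "u < z + h" "\<phi> (z + h) - \<phi> z = (z + h - z) * \<phi>' u"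
      using MVT2[OF \<open>z < z + h\<close>, of \<phi> \<phi>'] d1 S by (metis add_increasing2 add_le_cancel_left diff_le_eq h(1) less_eq_real_def)
    obtain v where v: "z - h < v" "v < z" "\<phi> z - \<phi> (z - h) = (z - (z - h)) * \<phi>' v"
      using MVT2[OF \<open>z - h < z\<close>, of \<phi> \<phi>'] d1 S by (metis add_increasing2 h(1) less_eq_real_def)
    have "\<phi>' z < \<phi>' u" "\<phi>' v < \<phi>' z" using r(2)[of "u - z"] l(2)[of "z - v"] u v h by auto
    then have "h * \<phi>' v < h * \<phi>' u" using h(1) by simp
    then have "2 * \<phi> z < \<phi> (z + h) + \<phi> (z - h)" using u(3) v(3) by simp
    moreover have "(\<phi> (z + h) + \<phi> (z - h)) / 2 \<le> \<phi> ((z + h + (z - h)) / 2)"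
      by (rule mid) (use S h in auto)
    ultimately show False by simp
  qed
  show ?thesis
  proof (rule DERIV_nonpos_imp_nonincreasing[OF xy(3), of \<phi>'])
    fix t assume "x \<le> t" "t \<le> y"
    then have "t \<in> S" using \<open>is_interval S\<close> xy unfolding is_interval_1 by blast
    then show "\<exists>d. (\<phi>' has_real_derivative d) (at t) \<and> d \<le> 0" using d2 nonpos by blast
  qed
qed

lemma has_real_derivative_antiderivative:
  fixes h :: "real \<Rightarrow> real"
  assumes "continuous_on {c..d} h"
  obtains H where "\<And>x. c < x \<Longrightarrow> x < d \<Longrightarrow> (H has_real_derivative h x) (at x)"
proof -
  obtain H where H: "\<And>x. x \<in> {c..d} \<Longrightarrow> (H has_vector_derivative h x) (at x within {c..d})"
    using antiderivative_continuous[OF assms] by blast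
  have "(H has_real_derivative h x) (at x)" if "c < x" "x < d" for x
    using H[of x] that unfolding has_real_derivative_iff_has_vector_derivative
    by (simp add: at_within_Icc_at)
  then show ?thesis using that by blast
qed

context time_map_problem
begin

text \<open>Put w = \<alpha> v / \<eta> and Y = \<theta> \<alpha> - \<theta> w. The expression is
  \<alpha> Y' + (m - 3) Y, where m comes from the factor P and -3 from differentiating
  \<open>E\<close> to the power -3/2 with \<alpha> E' = 2 E - Y. The remaining part of that term is
  the square 3 Y Y.\<close>

definition cross :: "(real \<Rightarrow> real) \<Rightarrow> real \<Rightarrow> real \<Rightarrow> real" where
  "cross m \<alpha> w = \<alpha> * d\<theta> \<alpha> - w * d\<theta> w + (m \<alpha> - 3) * (\<theta> \<alpha> - \<theta> w)"

text \<open>\<open>P\<close> is an integrating factor, \<open>P' = m P / \<alpha>\<close>, chosen so that the derivative of \<open>P dN\<close> is a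
  positive multiple of \<open>2 E cross + 3 (\<theta> \<alpha> - \<theta> w)\<^sup>2\<close> with \<open>w = \<alpha> v / \<eta>\<close>.\<close>

lemma weighted_dN_deriv:
  assumes \<alpha>: "\<eta> \<le> \<alpha>" "ereal \<alpha> < \<beta>\<^sub>2" and v: "0 < v" "v < \<eta>" and "0 < P \<alpha>"
    and P: "(P has_real_derivative P \<alpha> * (m \<alpha> / \<alpha>)) (at \<alpha>)"
    and "0 \<le> cross m \<alpha> (\<alpha> * v / \<eta>)"
    and "0 < cross m \<alpha> (\<alpha> * v / \<eta>) \<or> \<theta> (\<alpha> * v / \<eta>) \<noteq> \<theta> \<alpha>"
  shows "\<exists>d>0. ((\<lambda>x. P x * dN x v) has_real_derivative d) (at \<alpha>)"
proof -
  have E: "0 < E \<alpha> v" and \<alpha>0: "0 < \<alpha>" using E_pos assms \<eta>_pos by auto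
  define q where "q = sqrt (E \<alpha> v)"
  have q: "0 < q" "E \<alpha> v = q * q" using E by (auto simp: q_def)
  define w where "w = \<alpha> * v / \<eta>"
  have w: "0 < w" and vw: "v / \<eta> = w / \<alpha>" using \<alpha>0 v \<eta>_pos by (auto simp: w_def)
  define Y where "Y = \<theta> \<alpha> - \<theta> w"
  define E' where "E' = f \<alpha> - f w * (v / \<eta>)"
  define Y' where "Y' = d\<theta> \<alpha> - d\<theta> w * (v / \<eta>)"
  have sqrt_E: "sqrt (E \<alpha> v) = q" by (simp add: q_def)
  have dE: "((\<lambda>x. E x v) has_real_derivative E') (at \<alpha>)"
    unfolding E'_def w_def by (rule E_deriv[OF \<alpha>0 v(1)])
  have lin: "((\<lambda>x. x * v / \<eta>) has_real_derivative v / \<eta>) (at \<alpha>)"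
    using \<eta>_pos by (auto intro!: derivative_eq_intros)
  have dY: "((\<lambda>x. \<theta> x - \<theta> (x * v / \<eta>)) has_real_derivative Y') (at \<alpha>)"
    unfolding Y'_def w_def
    by (intro DERIV_diff \<theta>_deriv \<alpha>0 DERIV_chain2[OF \<theta>_deriv lin]) (use w in \<open>simp add: w_def\<close>)
  have dq: "((\<lambda>x. sqrt (E x v)) has_real_derivative inverse q / 2 * E') (at \<alpha>)"
    unfolding q_def by (rule DERIV_chain2[OF DERIV_real_sqrt[OF E] dE])
  have dEq: "((\<lambda>x. 2 * (E x v * sqrt (E x v))) has_real_derivative 2 * (E' * q + inverse q / 2 * E' * (q * q))) (at \<alpha>)"
    by (rule DERIV_cong[OF DERIV_cmult[OF DERIV_mult[OF dE dq]]]) (simp add: sqrt_E, simp add: q(2))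
  have ne: "2 * (E \<alpha> v * sqrt (E \<alpha> v)) \<noteq> 0" using E by simp
  have "((\<lambda>x. P x * ((\<theta> x - \<theta> (x * v / \<eta>)) / (2 * (E x v * sqrt (E x v))))) has_real_derivative
      P \<alpha> * (m \<alpha> / \<alpha>) * (Y / (2 * (q * q * q)))
      + (Y' * (2 * (q * q * q)) - Y * (2 * (E' * q + inverse q / 2 * E' * (q * q)))) / (2 * (q * q * q) * (2 * (q * q * q))) * P \<alpha>)
      (at \<alpha>)"
    by (rule DERIV_cong[OF DERIV_mult[OF P DERIV_divide[OF dY dEq ne]]])
      (simp only: sqrt_E w_def[symmetric] Y_def[symmetric], simp only: q(2))
  moreover have "P \<alpha> * (m \<alpha> / \<alpha>) * (Y / (2 * (q * q * q)))
      + (Y' * (2 * (q * q * q)) - Y * (2 * (E' * q + inverse q / 2 * E' * (q * q)))) / (2 * (q * q * q) * (2 * (q * q * q))) * P \<alpha>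
      = P \<alpha> * (2 * (q * q) * cross m \<alpha> w + 3 * Y\<^sup>2) / (4 * \<alpha> * q ^ 5)"
  proof -
    \<comment> \<open>\<open>\<alpha> * E'\<close> is
      \<open>\<alpha> * f \<alpha> - w * f w\<close>, and the definition of \<theta> trades these
      products for \<open>E\<close> and \<open>Y\<close>, so that no value of \<open>f\<close>
      remains.\<close>
    have "\<alpha> * E' = 2 * (q * q) - Y"
      using \<alpha>0 unfolding E'_def vw q(2)[symmetric]
      by (simp add: Y_def \<theta>_def E_def w_def field_simps)
    then have E': "E' = (2 * (q * q) - Y) / \<alpha>" using \<alpha>0 by (simp add: field_simps)
    have "\<alpha> * Y' = cross m \<alpha> w - (m \<alpha> - 3) * Y"
      using \<alpha>0 unfolding Y'_def vw by (simp add: cross_def Y_def field_simps)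
    then have Y': "Y' = (cross m \<alpha> w - (m \<alpha> - 3) * Y) / \<alpha>" using \<alpha>0 by (simp add: field_simps)
    show ?thesis
      unfolding E' Y' using q(1) \<alpha>0 by (simp add: field_simps power2_eq_square eval_nat_numeral)
  qed
  moreover have "0 < P \<alpha> * (2 * (q * q) * cross m \<alpha> w + 3 * Y\<^sup>2) / (4 * \<alpha> * q ^ 5)"
  proof -
    have "0 < 2 * (q * q) * cross m \<alpha> w + 3 * Y\<^sup>2"
    proof (cases "0 < cross m \<alpha> w")
      case True
      then show ?thesis using q(1) by (intro add_pos_nonneg) auto
    next
      case False
      then show ?thesis using q(1) assms(7,8) by (intro add_nonneg_pos) (auto simp: Y_def w_def)
    qed
    then show ?thesis using \<open>0 < P \<alpha>\<close> q(1) \<alpha>0 by simp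
  qed
  ultimately show ?thesis unfolding dN_def by (metis (no_types, lifting))
qed

end

context unimodal_time_map_problem
begin

text \<open>Continuity is asked down to \<open>\<beta>\<^sub>1\<close>, to the left of
  \<open>\<eta>\<close>, so that P and \<tau> are differentiable on both sides at amplitude
  \<open>\<eta>\<close> too. The last clause secures strict convexity when \<open>cross\<close>
  vanishes.\<close>

definition convexifying :: "(real \<Rightarrow> real) \<Rightarrow> bool" where
  "convexifying m \<longleftrightarrow> continuous_on {u. \<beta>\<^sub>1 < u \<and> ereal u < \<beta>\<^sub>2} m \<and>
     (\<forall>\<alpha> w. \<sigma> \<le> \<alpha> \<and> \<eta> \<le> \<alpha> \<and> ereal \<alpha> < \<beta>\<^sub>2 \<and> 0 < w \<and> w < \<alpha> \<longrightarrow>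
        0 \<le> cross m \<alpha> w \<and> (0 < cross m \<alpha> w \<or> \<theta> w \<noteq> \<theta> \<alpha>))"

lemma slope_increasing_exists:
  assumes m: "convexifying m" and a: "\<sigma> \<le> a" "\<eta> \<le> a" and b: "ereal b < \<beta>\<^sub>2"
  obtains P \<tau> where "slope_increasing a b P \<tau>"
proof -
  define c where "c = (\<beta>\<^sub>1 + a) / 2"
  have c: "\<beta>\<^sub>1 < c" "c < a" "0 < c" using a(2) \<beta>\<^sub>1_\<eta> \<beta>\<^sub>1_pos by (auto simp: c_def)
  obtain d where d: "b < d" "ereal d < \<beta>\<^sub>2" using amplitudes_above[OF b] .
  have sub: "{c..d} \<subseteq> {u. \<beta>\<^sub>1 < u \<and> ereal u < \<beta>\<^sub>2}" using c less_\<beta>\<^sub>2[of _ d] d by auto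
  have "continuous_on {c..d} m" using m sub continuous_on_subset unfolding convexifying_def by blast
  then have "continuous_on {c..d} (\<lambda>x. m x / x)" by (intro continuous_intros) (use c in auto)
  then obtain M where M: "\<And>x. c < x \<Longrightarrow> x < d \<Longrightarrow> (M has_real_derivative m x / x) (at x)"
    using has_real_derivative_antiderivative by blast
  define P where "P = (\<lambda>x. exp (M x))"
  have P: "(P has_real_derivative P x * (m x / x)) (at x)" if "c < x" "x < d" for x
    unfolding P_def by (rule DERIV_chain2[OF DERIV_exp M[OF that]])
  \<comment> \<open>P is known to be differentiable only inside \<open>{c..d}\<close>; the
    antiderivative of \<open>1 / P\<close> is taken over a smaller interval that still has
    \<open>{a..b}\<close> in its interior.\<close>
  define c' d' where "c' = (c + a) / 2" and "d' = (b + d) / 2"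
  have c'd': "c < c'" "c' < a" "b < d'" "d' < d" using c d by (auto simp: c'_def d'_def)
  have "continuous_on {c'..d'} (\<lambda>x. 1 / P x)"
    by (intro continuous_intros continuous_at_imp_continuous_on ballI DERIV_isCont[OF P])
      (use c'd' in \<open>simp_all add: P_def\<close>)
  then obtain \<tau> where \<tau>: "\<And>x. c' < x \<Longrightarrow> x < d' \<Longrightarrow> (\<tau> has_real_derivative 1 / P x) (at x)"
    using has_real_derivative_antiderivative by blast
  have "slope_increasing a b P \<tau>"
    unfolding slope_increasing_def
  proof (intro conjI ballI)
    fix x assume x: "x \<in> {a..b}"
    then show "0 < P x" "isCont P x" "(\<tau> has_real_derivative 1 / P x) (at x)"
      using DERIV_isCont[OF P[of x]] \<tau>[of x] c'd' c d by (auto simp: P_def)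
    fix v assume "v \<in> {0<..<\<eta>}"
    then have v: "0 < v" "v < \<eta>" by auto
    have x': "\<sigma> \<le> x" "\<eta> \<le> x" "ereal x < \<beta>\<^sub>2" "0 < x" using x a less_\<beta>\<^sub>2[OF _ b] \<eta>_pos by auto
    have w: "0 < x * v / \<eta>" "x * v / \<eta> < x" using scaled_mem[OF v x'(4)] by auto
    then have "0 \<le> cross m x (x * v / \<eta>) \<and> (0 < cross m x (x * v / \<eta>) \<or> \<theta> (x * v / \<eta>) \<noteq> \<theta> x)"
      using m x' unfolding convexifying_def by blast
    then show "\<exists>d>0. ((\<lambda>x. P x * dN x v) has_real_derivative d) (at x)"
      using x x' v c d P[of x] by (intro weighted_dN_deriv[where m = m]) (auto simp: P_def)
  qed
  then show ?thesis using that by blast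
qed

text \<open>Convexity is available only from \<sigma> on. For \<open>x\<close> below \<sigma> the
  time map decreases up to \<sigma>, and the two regimes are joined at \<sigma> itself.\<close>

lemma time_map_turn_on_amplitudes:
  assumes m: "convexifying m" and I: "x \<in> I" "y \<in> I" "z \<in> I" and "x < y" "y < z"
    and T: "time_map f z \<le> time_map f y"
  shows "time_map f y < time_map f x"
proof -
  have xz: "\<eta> < x" "ereal z < \<beta>\<^sub>2" using I by (auto simp: amplitudes_def)
  have turn: "time_map f y < time_map f x'" if x': "\<sigma> \<le> x'" "\<eta> < x'" "x' < y" for x'
  proof -
    obtain P \<tau> where "slope_increasing x' z P \<tau>"
      using slope_increasing_exists[OF m x'(1) _ xz(2)] x'(2) by auto
    then show ?thesis by (rule time_map_turn) (use x' xz \<open>y < z\<close> T in auto)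
  qed
  show ?thesis
  proof (cases "\<sigma> \<le> x")
    case False
    show ?thesis
    proof (cases "y \<le> \<sigma>")
      case False
      then have "time_map f y < time_map f \<sigma>" using turn[of \<sigma>] xz \<open>\<not> \<sigma> \<le> x\<close> by simp
      also have "\<dots> < time_map f x"
        using time_map_decreasing_up_to_\<sigma>[of x \<sigma>] xz \<open>\<not> \<sigma> \<le> x\<close> by simp
      finally show ?thesis .
    qed (use time_map_decreasing_up_to_\<sigma> xz \<open>x < y\<close> in auto)
  qed (use turn xz \<open>x < y\<close> in auto)
qed

lemma G_neg_if_\<eta>_less_\<sigma>:
  assumes "\<eta> < \<sigma>"
  shows "G_integral f \<eta> < 0"
proof -
  have "G_integral f \<eta> < ereal (integral {0..\<eta>} (\<lambda>_. 0))"
    unfolding G_integral_eq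
  proof (rule improper_integral_less[OF \<eta>_pos])
    fix v assume v: "0 < v" "v < \<eta>"
    have "dN \<eta> v < 0"
      by (rule dN_neg) (use v \<eta>_less \<eta>_pos \<theta>_decreasing[of v \<eta>] assms in auto)
    then show "2 * dN \<eta> v < 0" by simp
  qed (use N_cont \<eta>_less in \<open>auto intro!: continuous_intros\<close>)
  then show ?thesis by (simp add: zero_ereal_def)
qed

text \<open>\<open>0 \<le> G\<close> forces \<open>\<sigma> \<le> \<eta>\<close>, since below
  \<sigma> the integrand of G is negative throughout; hence convexity holds from \<eta> on.\<close>

lemma time_map_increasing_if_G_nonneg:
  assumes m: "convexifying m" and G: "0 \<le> G_integral f \<eta>"
  shows "strict_mono_on I (time_map f)"
proof (rule strict_mono_onI)
  fix x y assume xy: "x \<in> I" "y \<in> I" "x < y"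
  have "\<sigma> \<le> \<eta>" using G_neg_if_\<eta>_less_\<sigma> G by (meson leD le_less_linear)
  moreover have y: "ereal y < \<beta>\<^sub>2" "\<eta> < x" using xy by (auto simp: amplitudes_def)
  ultimately obtain P \<tau> where "slope_increasing \<eta> y P \<tau>"
    using slope_increasing_exists[OF m, of \<eta> y] by auto
  then show "time_map f x < time_map f y"
    by (rule time_map_less_if_G_nonneg) (use xy y G in auto)
qed

lemma time_map_not_increasing_if_G_neg:
  assumes m: "convexifying m" and G: "G_integral f \<eta> < 0"
  shows "\<not> strict_mono_on I (time_map f)"
proof
  assume T: "strict_mono_on I (time_map f)"
  show False
  proof (cases "\<eta> < \<sigma>")
    case True
    define x where "x = (\<eta> + \<sigma>) / 2"
    have x: "\<eta> < x" "x < \<sigma>" using True by (auto simp: x_def)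
    then have "x \<in> I" "\<sigma> \<in> I" using \<sigma>_less_\<beta>\<^sub>2 less_\<beta>\<^sub>2[of x \<sigma>] by (auto simp: amplitudes_def)
    then show False
      using strict_mono_onD[OF T _ _ x(2)] time_map_decreasing_up_to_\<sigma>[OF x order_refl] by simp
  next
    case False
    obtain b where b: "\<eta> < b" "ereal b < \<beta>\<^sub>2" using amplitudes_above[OF \<eta>_less] .
    obtain P \<tau> where "slope_increasing \<eta> b P \<tau>"
      using slope_increasing_exists[OF m, of \<eta> b] False b by auto
    then show False using G_nonneg_if_time_map_increasing[OF _ b T] G by (meson leD)
  qed
qed

lemma curve_shape:
  assumes m: "convexifying m" and \<alpha>\<^sub>1: "\<alpha>\<^sub>1 \<in> I" "\<sigma> \<le> \<alpha>\<^sub>1" "0 \<le> \<theta> \<alpha>\<^sub>1"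
  shows "(G_integral f \<eta> < 0 \<longrightarrow> curve_subset_shaped (bifurcation_curve f) (time_map f) I) \<and>
    (G_integral f \<eta> \<ge> 0 \<longrightarrow> curve_increasing (bifurcation_curve f) (time_map f) I)"
proof (intro conjI impI)
  assume G: "G_integral f \<eta> < 0"
  have "\<exists>\<alpha>\<^sub>0\<in>I. strict_antimono_on {\<alpha>\<in>I. \<alpha> \<le> \<alpha>\<^sub>0} (time_map f) \<and>
      strict_mono_on {\<alpha>\<in>I. \<alpha>\<^sub>0 \<le> \<alpha>} (time_map f)"
    by (rule valley_shape[OF open_amplitudes is_interval_amplitudes time_map_continuous _ \<alpha>\<^sub>1(1)
          time_map_increasing_from[OF \<alpha>\<^sub>1(2,3)] time_map_not_increasing_if_G_neg[OF m G]])
      (rule time_map_turn_on_amplitudes[OF m])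
  then show "curve_subset_shaped (bifurcation_curve f) (time_map f) I"
    using bifurcation_curve_described by (simp add: curve_subset_shaped_def)
next
  assume "0 \<le> G_integral f \<eta>"
  then show "curve_increasing (bifurcation_curve f) (time_map f) I"
    using bifurcation_curve_described time_map_increasing_if_G_nonneg[OF m]
    by (simp add: curve_increasing_def)
qed

text \<open>For finite \<open>\<beta>\<^sub>2\<close> the value of \<open>\<theta>\<close> there is
  \<open>2 * F \<beta>\<^sub>2 > 0\<close>, and continuity suffices. For infinite
  \<open>\<beta>\<^sub>2\<close>, negative \<open>\<theta>\<close> makes \<open>F u / u^2\<close>
  nondecreasing and drives F to infinity; each concavity hypothesis has to refute this in its own
  way.\<close>

lemma nonneg_\<theta>_exists:
  assumes "\<beta>\<^sub>2 = \<infinity> \<Longrightarrow> (\<And>x. \<sigma> < x \<Longrightarrow> \<eta> < x \<Longrightarrow> \<theta> x < 0) \<Longrightarrow> filterlim F at_top at_top \<Longrightarrow> False"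
  obtains \<alpha>\<^sub>1 where "\<alpha>\<^sub>1 \<in> I" "\<sigma> \<le> \<alpha>\<^sub>1" "0 \<le> \<theta> \<alpha>\<^sub>1"
proof -
  have "\<exists>\<alpha>\<^sub>1\<in>I. \<sigma> < \<alpha>\<^sub>1 \<and> 0 \<le> \<theta> \<alpha>\<^sub>1"
  proof (cases \<beta>\<^sub>2)
    case (real B)
    note B = f_\<beta>\<^sub>2[OF real]
    have "\<eta> < B" "\<sigma> < B" using real \<eta>_less \<sigma>_less_\<beta>\<^sub>2 by auto
    have "F \<eta> < F B"
    proof (rule DERIV_pos_imp_increasing_open[OF \<open>\<eta> < B\<close>])
      fix x assume "\<eta> < x" "x < B"
      then show "\<exists>y. (F has_real_derivative y) (at x) \<and> 0 < y"
        using F_deriv[of x] f_pos[of x] \<eta>_pos \<beta>\<^sub>1_\<eta> real by (intro exI[of _ "f x"]) auto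
    qed (use \<eta>_pos in \<open>auto intro!: continuous_on_subset[OF F_cont[of B]]\<close>)
    then have "0 < \<theta> B" using B F_\<eta> by (simp add: \<theta>_def)
    moreover have "(\<theta> \<longlongrightarrow> \<theta> B) (at_left B)"
      using \<theta>_isCont[OF B(1)] by (simp add: isCont_def filterlim_at_split)
    ultimately have "\<forall>\<^sub>F x in at_left B. 0 < \<theta> x" by (intro order_tendstoD)
    moreover have "\<forall>\<^sub>F x in at_left B. max \<sigma> \<eta> < x \<and> x < B"
      by (rule eventually_at_leftI[of "max \<sigma> \<eta>"]) (use \<open>\<eta> < B\<close> \<open>\<sigma> < B\<close> in auto)
    ultimately have "\<forall>\<^sub>F x in at_left B. 0 < \<theta> x \<and> max \<sigma> \<eta> < x \<and> x < B"
      by (rule eventually_conj)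
    then obtain x where "0 < \<theta> x" "max \<sigma> \<eta> < x" "x < B"
      using eventually_happens[of _ "at_left B"] by (auto simp: trivial_limit_at_left_real)
    then show ?thesis using real by (intro bexI[of _ x]) (auto simp: amplitudes_def)
  next
    case PInf
    show ?thesis
    proof (rule ccontr)
      assume "\<not> ?thesis"
      then have neg: "\<theta> x < 0" if "\<sigma> < x" "\<eta> < x" for x
        using that PInf by (force simp: amplitudes_def)
      define c where "c = max \<sigma> \<eta> + 1"
      have c: "\<sigma> < c" "\<eta> < c" "0 < c" using \<eta>_pos by (auto simp: c_def)
      define C where "C = F c / c\<^sup>2"
      have "0 < C" using F_pos[of c] c PInf by (simp add: C_def)
      have bound: "C * c * x \<le> F x" if x: "c \<le> x" for x
      proof -
        have "F c / c\<^sup>2 \<le> F x / x\<^sup>2"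
        proof (rule DERIV_nonneg_imp_nondecreasing[OF x])
          fix u assume u: "c \<le> u" "u \<le> x"
          have "((\<lambda>u. F u / u\<^sup>2) has_real_derivative (f u * u\<^sup>2 - F u * (2 * u)) / (u\<^sup>2 * u\<^sup>2)) (at u)"
            using u c by (auto intro!: derivative_eq_intros F_deriv)
          moreover have "f u * u\<^sup>2 - F u * (2 * u) = u * - \<theta> u"
            by (simp add: \<theta>_def algebra_simps power2_eq_square)
          moreover have "0 \<le> u * - \<theta> u / (u\<^sup>2 * u\<^sup>2)"
            using neg[of u] u c by (intro divide_nonneg_nonneg mult_nonneg_nonneg) auto
          ultimately show "\<exists>y. ((\<lambda>u. F u / u\<^sup>2) has_real_derivative y) (at u) \<and> 0 \<le> y" by auto
        qed
        then have "C * x\<^sup>2 \<le> F x" using x c by (simp add: C_def pos_le_divide_eq)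
        moreover have "C * (c * x) \<le> C * x\<^sup>2"
          using x c \<open>0 < C\<close> by (intro mult_left_mono) (auto simp: power2_eq_square)
        ultimately show ?thesis by simp
      qed
      have "filterlim (\<lambda>x. C * c * x) at_top at_top"
        by (rule filterlim_tendsto_pos_mult_at_top[OF tendsto_const _ filterlim_ident])
          (use \<open>0 < C\<close> c in simp)
      moreover have "\<forall>\<^sub>F x in at_top. C * c * x \<le> F x"
        using eventually_ge_at_top[of c] by eventually_elim (rule bound)
      ultimately have "filterlim F at_top at_top" by (rule filterlim_at_top_mono)
      then show False using assms[OF PInf] neg by blast
    qed
  qed (use \<eta>_less in auto)
  then show ?thesis using that by auto
qed

end

context unimodal_time_map_problem
begin

lemma d\<theta>_nonneg: "\<sigma> \<le> u \<Longrightarrow> ereal u < \<beta>\<^sub>2 \<Longrightarrow> 0 \<le> d\<theta> u"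
  using d\<theta>_pos[of u] d\<theta>_\<sigma> by (cases "u = \<sigma>") auto

lemma d\<theta>_nonpos: "0 < u \<Longrightarrow> u \<le> \<sigma> \<Longrightarrow> d\<theta> u \<le> 0"
  using d\<theta>_neg[of u] d\<theta>_\<sigma> by (cases "u = \<sigma>") auto

lemma scaled_d\<theta>_diff_pos:
  assumes "\<sigma> \<le> \<alpha>" "ereal \<alpha> < \<beta>\<^sub>2" "0 < w" "w < \<alpha>" "w \<le> \<sigma>"
  shows "0 < \<alpha> * d\<theta> \<alpha> - w * d\<theta> w"
proof (cases "\<sigma> = \<alpha>")
  case True
  have "w * d\<theta> w < 0" using d\<theta>_neg[of w] assms True by (simp add: mult_pos_neg)
  then show ?thesis using d\<theta>_\<sigma> True by simp
next
  case False
  then have "0 < \<alpha> * d\<theta> \<alpha>" using d\<theta>_pos[of \<alpha>] assms by simp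
  moreover have "w * d\<theta> w \<le> 0" using d\<theta>_nonpos[of w] assms by (simp add: mult_nonneg_nonpos)
  ultimately show ?thesis by simp
qed

section \<open>Concave nonlinearities\<close>

context
  assumes concave: "\<And>u. 0 < u \<Longrightarrow> ereal u < \<beta>\<^sub>2 \<Longrightarrow> deriv (deriv f) u < 0"
begin

lemma d\<theta>_increasing:
  assumes "0 < x" "x < y" "ereal y < \<beta>\<^sub>2"
  shows "d\<theta> x < d\<theta> y"
proof (rule DERIV_pos_imp_increasing[OF assms(2)])
  fix u assume u: "x \<le> u" "u \<le> y"
  then have u': "0 < u" "ereal u < \<beta>\<^sub>2" using assms less_\<beta>\<^sub>2[of u y] by auto
  have "(d\<theta> has_real_derivative - u * deriv (deriv f) u) (at u)"
    unfolding d\<theta>_def[abs_def]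
    using f_deriv[OF u'(1)] deriv_f_deriv[OF u'(1)] by (auto intro!: derivative_eq_intros)
  moreover have "0 < - u * deriv (deriv f) u" using concave[OF u'] u' by (simp add: mult_pos_neg)
  ultimately show "\<exists>d. (d\<theta> has_real_derivative d) (at u) \<and> 0 < d" by blast
qed

text \<open>With m = 3 the \<theta> difference drops out of \<open>cross\<close>, and what remains
  is the increment of \<open>u * d\<theta> u\<close>. It is positive by signs for
  \<open>w \<le> \<sigma>\<close> and by monotonicity of \<open>d\<theta>\<close> beyond.\<close>

lemma convexifying_concave: "convexifying (\<lambda>_. 3)"
  unfolding convexifying_def
proof (intro conjI allI impI)
  fix \<alpha> w assume "\<sigma> \<le> \<alpha> \<and> \<eta> \<le> \<alpha> \<and> ereal \<alpha> < \<beta>\<^sub>2 \<and> 0 < w \<and> w < \<alpha>"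
  then have *: "\<sigma> \<le> \<alpha>" "ereal \<alpha> < \<beta>\<^sub>2" "0 < w" "w < \<alpha>" by auto
  have "w * d\<theta> w < \<alpha> * d\<theta> \<alpha>"
  proof (cases "w \<le> \<sigma>")
    case False
    have "w * d\<theta> w < w * d\<theta> \<alpha>" using d\<theta>_increasing[OF *(3,4,2)] *(3) by simp
    also have "\<dots> \<le> \<alpha> * d\<theta> \<alpha>" using d\<theta>_nonneg[OF *(1,2)] *(4) by (simp add: mult_right_mono)
    finally show ?thesis .
  qed (use scaled_d\<theta>_diff_pos * in force)
  then show "0 \<le> cross (\<lambda>_. 3) \<alpha> w" "0 < cross (\<lambda>_. 3) \<alpha> w \<or> \<theta> w \<noteq> \<theta> \<alpha>"
    by (auto simp: cross_def)
qed simp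

lemma nonneg_\<theta>_exists_concave:
  obtains \<alpha>\<^sub>1 where "\<alpha>\<^sub>1 \<in> I" "\<sigma> \<le> \<alpha>\<^sub>1" "0 \<le> \<theta> \<alpha>\<^sub>1"
proof (rule nonneg_\<theta>_exists)
  assume inf: "\<beta>\<^sub>2 = \<infinity>" and neg: "\<And>x. \<sigma> < x \<Longrightarrow> \<eta> < x \<Longrightarrow> \<theta> x < 0"
  define c where "c = max \<sigma> \<eta> + 1"
  have c: "\<sigma> < c" "\<eta> < c" "0 < c" using \<eta>_pos by (auto simp: c_def)
  define k where "k = d\<theta> c"
  have k: "0 < k" using d\<theta>_pos[of c] c inf by (simp add: k_def)
  \<comment> \<open>Beyond \<open>c\<close> the slope of \<theta> is at least \<open>k\<close>, so
    at this point \<theta> would have climbed to at least 1.\<close>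
  define x where "x = c + (1 - \<theta> c) / k"
  have "c < x" using k neg[of c] c by (simp add: x_def)
  then obtain z where z: "c < z" "z < x" "\<theta> x - \<theta> c = (x - c) * d\<theta> z"
    using MVT2[of c x \<theta> d\<theta>] \<theta>_deriv c by (metis less_le_trans)
  have "(x - c) * k \<le> (x - c) * d\<theta> z"
    using d\<theta>_increasing[of c z] z c inf \<open>c < x\<close> by (intro mult_left_mono) (auto simp: k_def)
  moreover have "(x - c) * k = 1 - \<theta> c" using k by (simp add: x_def)
  ultimately show False using z(3) neg[of x] c \<open>c < x\<close> by simp
qed

end

section \<open>Geometrically concave nonlinearities\<close>

text \<open>The derivative of \<theta> with respect to F, equal to one minus the elasticity
  \<open>u * deriv f u / f u\<close> of \<open>f\<close>.\<close>

definition q :: "real \<Rightarrow> real" where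
  "q u = d\<theta> u / f u"

lemma f_pos': "\<sigma> \<le> u \<Longrightarrow> ereal u < \<beta>\<^sub>2 \<Longrightarrow> 0 < f u"
  using f_pos[of u] \<beta>\<^sub>1_less_\<sigma> by simp

context
  assumes geom: "geometrically_concave_on {u. \<sigma> < u \<and> ereal u < \<beta>\<^sub>2} f"
begin

text \<open>Geometric concavity is midpoint concavity of \<open>ln (f (exp t))\<close>, whose
  derivative is the elasticity of \<open>f\<close> at \<open>exp t\<close>, that is 1 - q.\<close>

lemma q_mono:
  assumes xy: "\<sigma> < x" "x \<le> y" "ereal y < \<beta>\<^sub>2"
  shows "q x \<le> q y"
proof -
  define S where "S = {t::real. \<sigma> < exp t \<and> ereal (exp t) < \<beta>\<^sub>2}"
  define h where "h = (\<lambda>u. u * deriv f u / f u)"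
  define \<phi>'' where "\<phi>'' = (\<lambda>t. let u = exp t in
    ((1 * deriv f u + deriv (deriv f) u * u) * f u - u * deriv f u * deriv f u) / (f u * f u) * u)"
  have "open S"
  proof -
    have "open {t. \<sigma> < exp t}" "open {t. ereal (exp t) < \<beta>\<^sub>2}"
      by (intro open_Collect_less continuous_intros continuous_on_ereal)+
    then show ?thesis unfolding S_def by (simp add: Collect_conj_eq open_Int)
  qed
  moreover have "is_interval S"
    unfolding is_interval_1
  proof (intro allI ballI impI)
    fix a b t assume "a \<in> S" "b \<in> S" and t: "a \<le> t \<and> t \<le> b"
    then have "\<sigma> < exp a" "ereal (exp b) < \<beta>\<^sub>2" by (auto simp: S_def)
    moreover have "exp a \<le> exp t" "exp t \<le> exp b" using t by auto
    ultimately show "t \<in> S" 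
      unfolding S_def using less_\<beta>\<^sub>2[of "exp t" "exp b"] less_le_trans[of \<sigma> "exp a" "exp t"]
      by auto
  qed
  moreover have S: "0 < f (exp t)" "\<sigma> < exp t" "ereal (exp t) < \<beta>\<^sub>2" if "t \<in> S" for t
    using that f_pos'[of "exp t"] by (auto simp: S_def)
  have d1: "((\<lambda>t. ln (f (exp t))) has_real_derivative h (exp t)) (at t)" if "t \<in> S" for t
  proof -
    have "((\<lambda>t. ln (f (exp t))) has_real_derivative inverse (f (exp t)) * (deriv f (exp t) * exp t)) (at t)"
      using S[OF that] by (intro DERIV_chain2[OF DERIV_ln] DERIV_chain2[OF f_deriv] DERIV_exp) auto
    then show ?thesis by (simp add: h_def field_simps)
  qed
  have d2: "((\<lambda>t. h (exp t)) has_real_derivative \<phi>'' t) (at t)" if "t \<in> S" for t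
    unfolding h_def \<phi>''_def Let_def using S[OF that]
    by (intro DERIV_chain2[OF _ DERIV_exp] DERIV_divide DERIV_mult DERIV_ident f_deriv deriv_f_deriv) auto
  have mid: "(ln (f (exp s)) + ln (f (exp t))) / 2 \<le> ln (f (exp ((s + t) / 2)))"
    if "s \<in> S" "t \<in> S" for s t
  proof -
    have "sqrt (exp s * exp t) = exp ((s + t) / 2)"
      by (rule real_sqrt_unique) (simp_all add: power2_eq_square exp_add[symmetric])
    moreover have "sqrt (f (exp s) * f (exp t)) \<le> f (sqrt (exp s * exp t))"
      using geom S[OF that(1)] S[OF that(2)] by (simp add: geometrically_concave_on_def)
    ultimately have "ln (sqrt (f (exp s) * f (exp t))) \<le> ln (f (exp ((s + t) / 2)))"
      using S(1)[OF that(1)] S(1)[OF that(2)] by (intro ln_mono) auto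
    then show ?thesis
      using S(1)[OF that(1)] S(1)[OF that(2)] by (simp add: ln_sqrt ln_mult)
  qed
  have "0 < x" "0 < y" using xy \<sigma>_pos by auto
  have "h (exp (ln y)) \<le> h (exp (ln x))"
    by (rule midpoint_concave_imp_deriv_antimono[where S = S, OF \<open>open S\<close> \<open>is_interval S\<close> d1 d2 mid])
      (use xy \<open>0 < x\<close> \<open>0 < y\<close> less_\<beta>\<^sub>2[of x y] in \<open>auto simp: S_def\<close>)
  moreover have "q u = 1 - h u" if "\<sigma> < u" "ereal u < \<beta>\<^sub>2" for u
    using f_pos'[of u] that by (simp add: q_def h_def d\<theta>_def field_simps)
  ultimately show ?thesis using xy \<open>0 < x\<close> \<open>0 < y\<close> less_\<beta>\<^sub>2[of x y] by simp
qed

lemma d\<theta>_eq_q: "\<sigma> \<le> u \<Longrightarrow> ereal u < \<beta>\<^sub>2 \<Longrightarrow> d\<theta> u = q u * f u"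
  using f_pos'[of u] by (simp add: q_def)

lemma q_nonneg: "\<sigma> \<le> u \<Longrightarrow> ereal u < \<beta>\<^sub>2 \<Longrightarrow> 0 \<le> q u"
  unfolding q_def using d\<theta>_nonneg f_pos'[of u] by simp

text \<open>Up to \<alpha> the rate q of \<theta> with respect to F is at most
  \<open>q \<alpha>\<close>, so \<theta> minus \<open>q \<alpha>\<close> times F does not
  increase.\<close>

lemma \<theta>_diff_le:
  assumes "\<sigma> < w" "w \<le> \<alpha>" "ereal \<alpha> < \<beta>\<^sub>2"
  shows "\<theta> \<alpha> - \<theta> w \<le> q \<alpha> * (F \<alpha> - F w)"
proof -
  have "\<theta> \<alpha> - q \<alpha> * F \<alpha> \<le> \<theta> w - q \<alpha> * F w"
  proof (rule DERIV_nonpos_imp_nonincreasing[OF assms(2), of "\<lambda>u. \<theta> u - q \<alpha> * F u"])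
    fix u assume u: "w \<le> u" "u \<le> \<alpha>"
    then have u': "\<sigma> < u" "0 < u" "ereal u < \<beta>\<^sub>2" using assms \<sigma>_pos less_\<beta>\<^sub>2[of u \<alpha>] by auto
    have "((\<lambda>u. \<theta> u - q \<alpha> * F u) has_real_derivative d\<theta> u - q \<alpha> * f u) (at u)"
      by (intro DERIV_diff DERIV_cmult \<theta>_deriv F_deriv u')
    moreover have "d\<theta> u \<le> q \<alpha> * f u"
      using d\<theta>_eq_q[of u] q_mono[OF u'(1) u(2) assms(3)] f_pos'[of u] u' by (simp add: mult_right_mono)
    ultimately show "\<exists>d. ((\<lambda>u. \<theta> u - q \<alpha> * F u) has_real_derivative d) (at u) \<and> d \<le> 0"
      by (intro exI[of _ "d\<theta> u - q \<alpha> * f u"]) simp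
  qed
  then show ?thesis by (simp add: right_diff_distrib)
qed

lemma convexifying_geometrically_concave: "convexifying (\<lambda>u. max 3 (q u + 1))"
  unfolding convexifying_def
proof (intro conjI allI impI)
  have "isCont q u" if "\<beta>\<^sub>1 < u" "ereal u < \<beta>\<^sub>2" for u
    unfolding q_def d\<theta>_def using that f_pos[of u] \<beta>\<^sub>1_pos
    by (intro continuous_intros f_cont deriv_f_cont) auto
  then show "continuous_on {u. \<beta>\<^sub>1 < u \<and> ereal u < \<beta>\<^sub>2} (\<lambda>u. max 3 (q u + 1))"
    by (intro continuous_intros continuous_at_imp_continuous_on) auto
next
  fix \<alpha> w assume "\<sigma> \<le> \<alpha> \<and> \<eta> \<le> \<alpha> \<and> ereal \<alpha> < \<beta>\<^sub>2 \<and> 0 < w \<and> w < \<alpha>"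
  then have *: "\<sigma> \<le> \<alpha>" "\<eta> \<le> \<alpha>" "ereal \<alpha> < \<beta>\<^sub>2" "0 < w" "w < \<alpha>" by auto
  define Q where "Q = q \<alpha>"
  define m :: "real \<Rightarrow> real" where "m = (\<lambda>u. max 3 (q u + 1))"
  have "0 < \<alpha>" using *(2) \<eta>_pos by simp
  have Q: "0 \<le> Q" "d\<theta> \<alpha> = Q * f \<alpha>" using q_nonneg d\<theta>_eq_q *(1,3) by (auto simp: Q_def)
  have "0 \<le> cross m \<alpha> w \<and> (0 < cross m \<alpha> w \<or> \<theta> w \<noteq> \<theta> \<alpha>)"
  proof (cases "w \<le> \<sigma>")
    case True
    show ?thesis
    proof (cases "Q \<le> 2")
      case True
      then have "cross m \<alpha> w = \<alpha> * d\<theta> \<alpha> - w * d\<theta> w" by (simp add: cross_def m_def Q_def[symmetric])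
      then show ?thesis using scaled_d\<theta>_diff_pos[OF *(1,3,4,5) \<open>w \<le> \<sigma>\<close>] by simp
    next
      case False
      \<comment> \<open>Arranged so that each term has a sign: \<open>F \<alpha> \<ge> 0\<close>
        because \<open>\<eta> \<le> \<alpha>\<close>, while \<open>d\<theta> w \<le> 0\<close> and
        \<open>\<theta> w < 0\<close> because \<open>w \<le> \<sigma>\<close>.\<close>
      have "cross m \<alpha> w = 2 * (\<alpha> * f \<alpha>) + 2 * ((Q - 2) * F \<alpha>) - w * d\<theta> w - (Q - 2) * \<theta> w"
        using False Q(2) by (simp add: cross_def m_def Q_def[symmetric] \<theta>_def[of \<alpha>] algebra_simps)
      moreover have "0 < \<alpha> * f \<alpha>" using f_pos'[OF *(1,3)] \<open>0 < \<alpha>\<close> by simp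
      moreover have "0 \<le> (Q - 2) * F \<alpha>"
        using F_pos[of \<alpha>] F_\<eta> * False by (cases "\<alpha> = \<eta>") auto
      moreover have "w * d\<theta> w \<le> 0" using d\<theta>_nonpos[of w] * True by (simp add: mult_nonneg_nonpos)
      moreover have "(Q - 2) * \<theta> w \<le> 0"
        using \<theta>_neg[of w] * True False by (intro mult_nonneg_nonpos) auto
      ultimately have "0 < cross m \<alpha> w" by linarith
      then show ?thesis by simp
    qed
  next
    case False
    define Y where "Y = \<theta> \<alpha> - \<theta> w"
    define e where "e = F \<alpha> - F w"
    have w: "\<sigma> < w" "ereal w < \<beta>\<^sub>2" using False * less_\<beta>\<^sub>2[of w \<alpha>] by auto
    have "0 < Y" using \<theta>_increasing[of w \<alpha>] w * by (simp add: Y_def)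
    have Y: "Y \<le> Q * e" using \<theta>_diff_le[OF w(1) less_imp_le[OF *(5)] *(3)] by (simp add: Y_def Q_def e_def)
    have "0 < e" using F_less[OF *(4,5,2,3)] by (simp add: e_def)
    have "w * d\<theta> w \<le> w * (Q * f w)"
      using d\<theta>_eq_q[of w] q_mono[of w \<alpha>] f_pos'[of w] w *
      by (intro mult_left_mono) (auto simp: Q_def mult_right_mono)
    moreover have "\<alpha> * f \<alpha> - w * f w = 2 * e - Y" by (simp add: Y_def e_def \<theta>_def)
    then have "\<alpha> * (Q * f \<alpha>) - w * (Q * f w) = Q * (2 * e - Y)"
      by (metis mult.left_commute right_diff_distrib)
    ultimately have le: "Q * (2 * e - Y) + (m \<alpha> - 3) * Y \<le> cross m \<alpha> w"
      unfolding cross_def Y_def[symmetric] Q(2) by linarith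
    \<comment> \<open>For \<open>Q \<le> 2\<close> the chain
      \<open>Y \<le> Q * e \<le> 2 * e\<close> suffices. For \<open>Q > 2\<close> the surplus
      \<open>m \<alpha> - 3 = Q - 2\<close> reduces the coefficient of \<open>Y\<close> from
      \<open>- Q\<close> to \<open>- 2\<close>, exactly what \<open>Y \<le> Q * e\<close> can
      absorb.\<close>
    have "0 \<le> Q * (2 * e - Y) + (m \<alpha> - 3) * Y"
    proof (cases "Q \<le> 2")
      case True
      have "Q * e \<le> 2 * e" using True \<open>0 < e\<close> by simp
      then have "0 \<le> Q * (2 * e - Y)" using Y Q(1) by simp
      then show ?thesis using True by (simp add: m_def Q_def[symmetric])
    next
      case False
      have "Q * (2 * e - Y) + (m \<alpha> - 3) * Y = 2 * (Q * e - Y)"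
        using False by (simp add: m_def Q_def[symmetric] algebra_simps)
      then show ?thesis using Y by simp
    qed
    then show ?thesis using le \<open>0 < Y\<close> by (simp add: Y_def)
  qed
  then show "0 \<le> cross (\<lambda>u. max 3 (q u + 1)) \<alpha> w"
    "0 < cross (\<lambda>u. max 3 (q u + 1)) \<alpha> w \<or> \<theta> w \<noteq> \<theta> \<alpha>"
    by (simp_all add: m_def)
qed

text \<open>Beyond \<open>c\<close> the rate q is at least \<open>q c > 0\<close>, so \<theta> grows
  at least as fast as a positive multiple of F, and F tends to infinity.\<close>

lemma nonneg_\<theta>_exists_geometrically_concave:
  obtains \<alpha>\<^sub>1 where "\<alpha>\<^sub>1 \<in> I" "\<sigma> \<le> \<alpha>\<^sub>1" "0 \<le> \<theta> \<alpha>\<^sub>1"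
proof (rule nonneg_\<theta>_exists)
  assume inf: "\<beta>\<^sub>2 = \<infinity>" and neg: "\<And>x. \<sigma> < x \<Longrightarrow> \<eta> < x \<Longrightarrow> \<theta> x < 0"
    and F_lim: "filterlim F at_top at_top"
  define c where "c = max \<sigma> \<eta> + 1"
  have c: "\<sigma> < c" "\<eta> < c" "0 < c" using \<eta>_pos by (auto simp: c_def)
  define k where "k = q c"
  have k: "0 < k" using d\<theta>_pos[of c] f_pos'[of c] c inf by (simp add: k_def q_def)
  have "\<forall>\<^sub>F x in at_top. F c - \<theta> c / k \<le> F x \<and> c \<le> x"
    using F_lim eventually_ge_at_top[of c] by (auto simp: filterlim_at_top intro: eventually_conj)
  then obtain x where x: "F c - \<theta> c / k \<le> F x" "c \<le> x"
    using eventually_happens[of _ "at_top :: real filter"] by auto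
  have "\<theta> c - k * F c \<le> \<theta> x - k * F x"
  proof (rule DERIV_nonneg_imp_nondecreasing[OF x(2), of "\<lambda>u. \<theta> u - k * F u"])
    fix u assume u: "c \<le> u" "u \<le> x"
    have "((\<lambda>u. \<theta> u - k * F u) has_real_derivative d\<theta> u - k * f u) (at u)"
      by (intro DERIV_diff DERIV_cmult \<theta>_deriv F_deriv) (use u c in auto)
    moreover have "k * f u \<le> d\<theta> u"
      using d\<theta>_eq_q[of u] q_mono[of c u] f_pos'[of u] u c inf by (simp add: k_def mult_right_mono)
    ultimately show "\<exists>d. ((\<lambda>u. \<theta> u - k * F u) has_real_derivative d) (at u) \<and> 0 \<le> d"
      by (intro exI[of _ "d\<theta> u - k * f u"]) simp
  qed
  moreover have "k * (F c - \<theta> c / k) \<le> k * F x" using x(1) k by (intro mult_left_mono) auto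
  then have "k * F c - \<theta> c \<le> k * F x" using k by (simp add: right_diff_distrib)
  ultimately show False using neg[of x] x(2) c by simp
qed

end

end

section \<open>Assembly of the three cases\<close>

theorem theorem4:
  fixes f :: "real \<Rightarrow> real" and \<beta>\<^sub>1 \<eta> :: real and \<beta>\<^sub>2 :: ereal
  assumes "C2_on {0<..} f"
    and "0 < \<beta>\<^sub>1" and "ereal \<beta>\<^sub>1 < \<beta>\<^sub>2"
    and "\<And>u. \<beta>\<^sub>1 < u \<Longrightarrow> ereal u < \<beta>\<^sub>2 \<Longrightarrow> f u > 0"
    and "\<And>u. 0 < u \<Longrightarrow> u < \<beta>\<^sub>1 \<Longrightarrow> f u < 0"
    and "\<And>u. \<beta>\<^sub>2 < ereal u \<Longrightarrow> f u < 0"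
    and "\<And>u. 0 < u \<Longrightarrow> f integrable_on {0..u}"
    and "\<beta>\<^sub>1 < \<eta>" and "ereal \<eta> < \<beta>\<^sub>2" and "primitive f \<eta> = 0"
  shows "(quotient_increasing f \<beta>\<^sub>2 \<longrightarrow>
            curve_decreasing (bifurcation_curve f) (time_map f) (amplitudes \<eta> \<beta>\<^sub>2))
       \<and> ((\<exists>\<sigma>. quotient_unimodal f \<beta>\<^sub>2 \<sigma> \<and>
               geometrically_concave_on {u. \<sigma> < u \<and> ereal u < \<beta>\<^sub>2} f) \<or>
          (\<exists>\<sigma>. quotient_unimodal f \<beta>\<^sub>2 \<sigma>) \<and>
            (\<forall>u. 0 < u \<and> ereal u < \<beta>\<^sub>2 \<longrightarrow> deriv (deriv f) u < 0) \<longrightarrow>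
            (G_integral f \<eta> < 0 \<longrightarrow>
               curve_subset_shaped (bifurcation_curve f) (time_map f) (amplitudes \<eta> \<beta>\<^sub>2)) \<and>
            (G_integral f \<eta> \<ge> 0 \<longrightarrow>
               curve_increasing (bifurcation_curve f) (time_map f) (amplitudes \<eta> \<beta>\<^sub>2)))"
    (is "(_ \<longrightarrow> _) \<and> (?H3 \<or> ?H4 \<longrightarrow> ?shape)")
proof -
  interpret time_map_problem f \<beta>\<^sub>1 \<eta> \<beta>\<^sub>2 by unfold_locales (fact assms)+
  have "curve_decreasing (bifurcation_curve f) (time_map f) I" if "quotient_increasing f \<beta>\<^sub>2"
    using bifurcation_curve_described time_map_decreasing_if_quotient_increasing[OF that]
    by (simp add: curve_decreasing_def)
  moreover have ?shape if ?H3
  proof -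
    obtain \<sigma> where "quotient_unimodal f \<beta>\<^sub>2 \<sigma>"
      and geom: "geometrically_concave_on {u. \<sigma> < u \<and> ereal u < \<beta>\<^sub>2} f"
      using \<open>?H3\<close> by blast
    then interpret unimodal_time_map_problem f \<beta>\<^sub>1 \<eta> \<beta>\<^sub>2 \<sigma> by unfold_locales
    show ?shape
      using nonneg_\<theta>_exists_geometrically_concave[OF geom]
        curve_shape[OF convexifying_geometrically_concave[OF geom]] by metis
  qed
  moreover have ?shape if ?H4
  proof -
    obtain \<sigma> where "quotient_unimodal f \<beta>\<^sub>2 \<sigma>" using \<open>?H4\<close> by blast
    then interpret unimodal_time_map_problem f \<beta>\<^sub>1 \<eta> \<beta>\<^sub>2 \<sigma> by unfold_locales
    have concave: "\<And>u. 0 < u \<Longrightarrow> ereal u < \<beta>\<^sub>2 \<Longrightarrow> deriv (deriv f) u < 0" using \<open>?H4\<close> by blast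
    show ?shape
      using nonneg_\<theta>_exists_concave[OF concave] curve_shape[OF convexifying_concave[OF concave]]
      by metis
  qed
  ultimately show ?thesis by blast
qed

end
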